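(* Let $d_1,d_3,\beta_1,\beta_3,\kappa_1,\kappa_2,\alpha_1,\alpha_2,\alpha_3,\alpha_4$ be arbitrary nonnegative real constants with $d_1d_3\kappa_1\kappa_2\neq 0$ and $\alpha_1^2+\alpha_3^2\neq 0$. Consider the system for the unknown functions $u(t,x),v(t,x),w(t,x)$ $$u_t = d_1u_{xx}+\beta_1u(1-u)-\alpha_1uw+\alpha_2uv,$$ $$v_t = v_{xx}+ v(1-v)+(\kappa_1\alpha_3+\kappa_2\alpha_1)uw-(\kappa_2\alpha_2u+\kappa_1\alpha_4w)v,$$ $$w_t = d_3 w_{xx}+\beta_3w(1-w)-\alpha_3uw+\alpha_4vw.$$ Then this system is invariant only with respect to the time and space translations generated by the Lie symmetries $P_t=\frac{\partial}{\partial t}$, $P_x=\frac{\partial}{\partial x}$; that is, every Lie symmetry of the system is a linear combination of $P_t$ and $P_x$ with constant real coefficients (and $P_t$, $P_x$ are Lie symmetries).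
   Context: A Lie symmetry (infinitesimal Lie point symmetry) of the system is a smooth vector field $X=\xi^0\partial_t+\xi^1\partial_x+\eta^1\partial_u+\eta^2\partial_v+\eta^3\partial_w$, with $\xi^0,\xi^1,\eta^1,\eta^2,\eta^3$ functions of $(t,x,u,v,w)$, satisfying Lie's infinitesimal invariance criterion: the second prolongation of $X$, applied to each of the three equations (regarded as functions on the second-order jet space), vanishes on the set of points of the jet space where all three equations hold. *)

theory Defs
  imports "HOL-Analysis.Analysis"
begin

text \<open>Independent variables \<open>t, x\<close>; the dependent variables \<open>u, v, w\<close> are the components
  \<open>1, 2, 3\<close> of one vector \<open>U\<close>. Points are written \<open>(t, x, U)\<close>, \<open>((t, x, U), U\<^sub>t, U\<^sub>x)\<close> and
  \<open>(((t, x, U), U\<^sub>t, U\<^sub>x), U\<^sub>t\<^sub>t, U\<^sub>t\<^sub>x, U\<^sub>x\<^sub>x)\<close>.\<close>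

type_synonym base = "real \<times> real \<times> (real^3)"
type_synonym jet1 = "base \<times> (real^3) \<times> (real^3)"
type_synonym jet2 = "jet1 \<times> (real^3) \<times> (real^3) \<times> (real^3)"

text \<open>Differentiability classes on an open set \<open>S\<close>, through iterated partial
  derivatives.\<close>

primrec Ck_on :: "nat \<Rightarrow> 'a::euclidean_space set \<Rightarrow> ('a \<Rightarrow> 'b::real_normed_vector) \<Rightarrow> bool" where
  "Ck_on 0 S f \<longleftrightarrow> continuous_on S f"
| "Ck_on (Suc k) S f \<longleftrightarrow>
     (\<forall>p\<in>S. f differentiable (at p)) \<and>
     (\<forall>i\<in>Basis. Ck_on k S (\<lambda>p. frechet_derivative f (at p) i))"

definition smooth_on :: "'a::euclidean_space set \<Rightarrow> ('a \<Rightarrow> 'b::real_normed_vector) \<Rightarrow> bool" where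
  "smooth_on S f \<longleftrightarrow> (\<forall>k. Ck_on k S f)"

text \<open>Total derivatives. A total derivative is a derivation along a vector field on jet space, so it
  is written as a directional derivative; for instance
  \<open>D\<^sub>t F = F\<^sub>t + \<Sum>\<^sub>a u\<^sup>a\<^sub>t \<partial>F/\<partial>u\<^sup>a + \<Sum>\<^sub>a u\<^sup>a\<^sub>t\<^sub>t \<partial>F/\<partial>u\<^sup>a\<^sub>t + \<Sum>\<^sub>a u\<^sup>a\<^sub>t\<^sub>x \<partial>F/\<partial>u\<^sup>a\<^sub>x\<close>. The index 0 or 1 is the order
  of the jets on which the differentiated function lives.\<close>

definition Dt0 :: "(base \<Rightarrow> 'b::real_normed_vector) \<Rightarrow> jet1 \<Rightarrow> 'b" where
  "Dt0 f = (\<lambda>(p, Ut, Ux). frechet_derivative f (at p) (1, 0, Ut))"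

definition Dx0 :: "(base \<Rightarrow> 'b::real_normed_vector) \<Rightarrow> jet1 \<Rightarrow> 'b" where
  "Dx0 f = (\<lambda>(p, Ut, Ux). frechet_derivative f (at p) (0, 1, Ux))"

definition Dt1 :: "(jet1 \<Rightarrow> 'b::real_normed_vector) \<Rightarrow> jet2 \<Rightarrow> 'b" where
  "Dt1 F = (\<lambda>((p, Ut, Ux), Utt, Utx, Uxx).
     frechet_derivative F (at (p, Ut, Ux)) ((1, 0, Ut), Utt, Utx))"

definition Dx1 :: "(jet1 \<Rightarrow> 'b::real_normed_vector) \<Rightarrow> jet2 \<Rightarrow> 'b" where
  "Dx1 F = (\<lambda>((p, Ut, Ux), Utt, Utx, Uxx).
     frechet_derivative F (at (p, Ut, Ux)) ((0, 1, Ux), Utx, Uxx))"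

text \<open>A vector field is the map \<open>X = (\<xi>\<^sup>0, \<xi>\<^sup>1, \<eta>)\<close> of its coefficients, with
  \<open>\<eta> = (\<eta>\<^sup>1, \<eta>\<^sup>2, \<eta>\<^sup>3)\<close>.\<close>

definition xi0 :: "(base \<Rightarrow> base) \<Rightarrow> base \<Rightarrow> real" where "xi0 X p = fst (X p)"
definition xi1 :: "(base \<Rightarrow> base) \<Rightarrow> base \<Rightarrow> real" where "xi1 X p = fst (snd (X p))"
definition eta :: "(base \<Rightarrow> base) \<Rightarrow> base \<Rightarrow> real^3" where "eta X p = snd (snd (X p))"

text \<open>Coefficients of the prolongation:
  \<open>\<zeta>\<^sub>i = D\<^sub>i \<eta> - \<Sum>\<^sub>j U\<^sub>j D\<^sub>i \<xi>\<^sup>j\<close> and \<open>\<zeta>\<^sub>i\<^sub>j = D\<^sub>j \<zeta>\<^sub>i - \<Sum>\<^sub>k U\<^sub>i\<^sub>k D\<^sub>j \<xi>\<^sup>k\<close>.\<close>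

definition zeta_t :: "(base \<Rightarrow> base) \<Rightarrow> jet1 \<Rightarrow> real^3" where
  "zeta_t X = (\<lambda>(p, Ut, Ux). let z = (p, Ut, Ux) in
     Dt0 (eta X) z - Dt0 (xi0 X) z *\<^sub>R Ut - Dt0 (xi1 X) z *\<^sub>R Ux)"

definition zeta_x :: "(base \<Rightarrow> base) \<Rightarrow> jet1 \<Rightarrow> real^3" where
  "zeta_x X = (\<lambda>(p, Ut, Ux). let z = (p, Ut, Ux) in
     Dx0 (eta X) z - Dx0 (xi0 X) z *\<^sub>R Ut - Dx0 (xi1 X) z *\<^sub>R Ux)"

definition zeta_tt :: "(base \<Rightarrow> base) \<Rightarrow> jet2 \<Rightarrow> real^3" where
  "zeta_tt X = (\<lambda>(z, Utt, Utx, Uxx).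
     Dt1 (zeta_t X) (z, Utt, Utx, Uxx) - Dt0 (xi0 X) z *\<^sub>R Utt - Dt0 (xi1 X) z *\<^sub>R Utx)"

definition zeta_tx :: "(base \<Rightarrow> base) \<Rightarrow> jet2 \<Rightarrow> real^3" where
  "zeta_tx X = (\<lambda>(z, Utt, Utx, Uxx).
     Dx1 (zeta_t X) (z, Utt, Utx, Uxx) - Dx0 (xi0 X) z *\<^sub>R Utt - Dx0 (xi1 X) z *\<^sub>R Utx)"

definition zeta_xx :: "(base \<Rightarrow> base) \<Rightarrow> jet2 \<Rightarrow> real^3" where
  "zeta_xx X = (\<lambda>(z, Utt, Utx, Uxx).
     Dx1 (zeta_x X) (z, Utt, Utx, Uxx) - Dx0 (xi0 X) z *\<^sub>R Utx - Dx0 (xi1 X) z *\<^sub>R Uxx)"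

definition prolong2 :: "(base \<Rightarrow> base) \<Rightarrow> jet2 \<Rightarrow> jet2" where
  "prolong2 X = (\<lambda>(z, J). ((X (fst z), zeta_t X z, zeta_x X z),
     zeta_tt X (z, J), zeta_tx X (z, J), zeta_xx X (z, J)))"

text \<open>\<open>E\<close> is a set of functions on second-order jet space, standing for the system of equations
  \<open>F = 0\<close> with \<open>F \<in> E\<close>. The vector field \<open>X\<close> is defined on the open set \<open>D\<close>: its values
  outside \<open>D\<close> are irrelevant. A vector field acts on a function as a directional derivative.\<close>

definition lie_symmetry :: "base set \<Rightarrow> (jet2 \<Rightarrow> real) set \<Rightarrow> (base \<Rightarrow> base) \<Rightarrow> bool" where
  "lie_symmetry D E X \<longleftrightarrow> smooth_on D X \<and>
     (\<forall>F\<in>E. \<forall>j. fst (fst j) \<in> D \<and> (\<forall>G\<in>E. G j = 0)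
        \<longrightarrow> frechet_derivative F (at j) (prolong2 X j) = 0)"

definition P_t :: "base \<Rightarrow> base" where "P_t = (\<lambda>_. (1, 0, 0))"
definition P_x :: "base \<Rightarrow> base" where "P_x = (\<lambda>_. (0, 1, 0))"

definition eq_u :: "real \<Rightarrow> real \<Rightarrow> real \<Rightarrow> real \<Rightarrow> jet2 \<Rightarrow> real" where
  "eq_u d1 \<beta>1 \<alpha>1 \<alpha>2 = (\<lambda>(((t, x, U), Ut, Ux), Utt, Utx, Uxx).
     let u = U $ 1; v = U $ 2; w = U $ 3 in
     Ut $ 1 - (d1 * Uxx $ 1 + \<beta>1 * u * (1 - u) - \<alpha>1 * u * w + \<alpha>2 * u * v))"

definition eq_v ::
  "real \<Rightarrow> real \<Rightarrow> real \<Rightarrow> real \<Rightarrow> real \<Rightarrow> real \<Rightarrow> jet2 \<Rightarrow> real" where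
  "eq_v \<kappa>1 \<kappa>2 \<alpha>1 \<alpha>2 \<alpha>3 \<alpha>4 = (\<lambda>(((t, x, U), Ut, Ux), Utt, Utx, Uxx).
     let u = U $ 1; v = U $ 2; w = U $ 3 in
     Ut $ 2 - (Uxx $ 2 + v * (1 - v) + (\<kappa>1 * \<alpha>3 + \<kappa>2 * \<alpha>1) * u * w
                 - (\<kappa>2 * \<alpha>2 * u + \<kappa>1 * \<alpha>4 * w) * v))"

definition eq_w :: "real \<Rightarrow> real \<Rightarrow> real \<Rightarrow> real \<Rightarrow> jet2 \<Rightarrow> real" where
  "eq_w d3 \<beta>3 \<alpha>3 \<alpha>4 = (\<lambda>(((t, x, U), Ut, Ux), Utt, Utx, Uxx).
     let u = U $ 1; v = U $ 2; w = U $ 3 in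
     Ut $ 3 - (d3 * Uxx $ 3 + \<beta>3 * w * (1 - w) - \<alpha>3 * u * w + \<alpha>4 * v * w))"

definition rd_system ::
  "real \<Rightarrow> real \<Rightarrow> real \<Rightarrow> real \<Rightarrow> real \<Rightarrow> real \<Rightarrow> real \<Rightarrow> real \<Rightarrow> real \<Rightarrow> real \<Rightarrow> (jet2 \<Rightarrow> real) set" where
  "rd_system d1 d3 \<beta>1 \<beta>3 \<kappa>1 \<kappa>2 \<alpha>1 \<alpha>2 \<alpha>3 \<alpha>4 =
     {eq_u d1 \<beta>1 \<alpha>1 \<alpha>2, eq_v \<kappa>1 \<kappa>2 \<alpha>1 \<alpha>2 \<alpha>3 \<alpha>4, eq_w d3 \<beta>3 \<alpha>3 \<alpha>4}"

end

theory Submission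
  imports Defs
begin

text \<open>
  On solutions of \<open>U\<^sub>t = d U\<^sub>x\<^sub>x + R(U)\<close> the jet coordinates \<open>U\<^sub>x, U\<^sub>t\<^sub>x, U\<^sub>x\<^sub>x\<close> are free, so the invariance
  condition splits into its coefficients: \<open>\<xi>\<^sup>0\<close> depends on \<open>t\<close> only, \<open>\<xi>\<^sup>1\<close> on \<open>(t, x)\<close> only,
  \<open>\<xi>\<^sup>0\<^sub>t = 2 \<xi>\<^sup>1\<^sub>x\<close>, \<open>\<eta>\<close> is affine in \<open>U\<close>, and \<open>\<eta>\<^sub>t + \<eta>\<^sub>U R - \<xi>\<^sup>0\<^sub>t R = d \<eta>\<^sub>x\<^sub>x + R'(U) \<eta>\<close>. Differentiating the
  last equation twice in \<open>U\<close>, for \<open>R(U) = L U + B(U, U) / 2\<close>, shows that \<open>\<eta>\<^sub>U + \<xi>\<^sup>0\<^sub>t\<close> is a derivation of the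
  commutative algebra with product \<open>B\<close>. In the system at hand that algebra has no derivation but 0, so
  \<open>\<eta>\<^sub>U = - \<xi>\<^sup>0\<^sub>t\<close>. What remains is \<open>B(Y, b) = - \<xi>\<^sup>0\<^sub>t L Y\<close> and \<open>\<eta>\<^sub>t - d \<eta>\<^sub>x\<^sub>x = L b\<close> for
  \<open>b = \<eta> + \<xi>\<^sup>0\<^sub>t U\<close>; the logistic term of \<open>v\<close> gives \<open>b\<^sub>2 = \<xi>\<^sup>0\<^sub>t / 2\<close> in the first equation and \<open>b\<^sub>2 = 0\<close> in
  the second, whence \<open>\<xi>\<^sup>0\<^sub>t = 0\<close> and \<open>\<eta> = 0\<close>.
\<close>

subsection \<open>Directional derivatives of smooth functions\<close>

text \<open>As a function of the base point the derivative can be iterated: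
  \<open>dird u (dird v f)\<close> is a second derivative with inner direction
  \<open>v\<close>.\<close>

definition dird :: "'a::real_normed_vector \<Rightarrow> ('a \<Rightarrow> 'b::real_normed_vector) \<Rightarrow> 'a \<Rightarrow> 'b" where
  "dird v f = (\<lambda>p. frechet_derivative f (at p) v)"

lemma has_derivative_dird:
  "f differentiable (at p) \<Longrightarrow> (f has_derivative (\<lambda>v. dird v f p)) (at p)"
  unfolding dird_def by (simp add: frechet_derivative_works[symmetric])

lemma dird_eq: "(f has_derivative f') (at p) \<Longrightarrow> dird v f p = f' v"
  unfolding dird_def by (metis frechet_derivative_at)

text \<open>Functions that agree near \<open>p\<close> have the same derivatives there, so the
  choice hidden in \<open>frechet_derivative\<close> agrees as well, whether or not a derivative
  exists.\<close>

lemma dird_cong: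
  assumes "open S" "p \<in> S" "\<And>q. q \<in> S \<Longrightarrow> f q = g q"
  shows "dird v f p = dird v g p"
proof -
  have "(f has_derivative D) (at p) \<longleftrightarrow> (g has_derivative D) (at p)" for D
    using has_derivative_transform_within_open[OF _ assms(1,2), of f D UNIV g]
      has_derivative_transform_within_open[OF _ assms(1,2), of g D UNIV f] assms(3) by auto
  then show ?thesis unfolding dird_def frechet_derivative_def by simp
qed

lemma differentiable_cong_open:
  assumes "open S" "p \<in> S" "\<And>q. q \<in> S \<Longrightarrow> f q = g q" "f differentiable (at p)"
  shows "g differentiable (at p)"
  using has_derivative_transform_within_open[OF _ assms(1,2), of f _ UNIV g] assms(3,4)
  unfolding differentiable_def by blast

text \<open>This confines \<open>Ck_on\<close> to the values on \<open>S\<close>, so that a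
  derivative may be replaced by a formula valid only there.\<close>

lemma Ck_on_cong:
  assumes "open S" "\<And>q. q \<in> S \<Longrightarrow> f q = g q" "Ck_on k S f"
  shows "Ck_on k S g"
  using assms(2,3)
proof (induction k arbitrary: f g)
  case 0
  then show ?case using continuous_on_cong[of S S f g] by simp
next
  case (Suc k)
  have "Ck_on k S (\<lambda>p. frechet_derivative g (at p) i)" if "i \<in> Basis" for i
  proof (rule Suc.IH)
    show "frechet_derivative f (at q) i = frechet_derivative g (at q) i" if "q \<in> S" for q
      using dird_cong[OF assms(1) that, of f g i] Suc.prems(1) unfolding dird_def by blast
    show "Ck_on k S (\<lambda>p. frechet_derivative f (at p) i)"
      using Suc.prems(2) that by simp
  qed
  moreover have "g differentiable (at p)" if "p \<in> S" for p
    using differentiable_cong_open[OF assms(1) that, of f g] Suc.prems that by simp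
  ultimately show ?case by simp
qed

lemma Ck_on_compose_linear:
  fixes f :: "'a::euclidean_space \<Rightarrow> 'b::real_normed_vector"
  assumes "open S" "bounded_linear L" "Ck_on k S f"
  shows "Ck_on k S (\<lambda>p. L (f p))"
  using assms(3)
proof (induction k arbitrary: f)
  case 0
  then show ?case
    by (auto intro: bounded_linear.continuous_on[OF assms(2)])
next
  case (Suc k)
  have d: "((\<lambda>p. L (f p)) has_derivative (\<lambda>v. L (dird v f p))) (at p)" if "p \<in> S" for p
    using Suc.prems that
    by (intro bounded_linear.has_derivative[OF assms(2)] has_derivative_dird) auto
  have "Ck_on k S (\<lambda>p. frechet_derivative (\<lambda>p. L (f p)) (at p) i)" if "i \<in> Basis" for i
  proof (rule Ck_on_cong[OF assms(1)])
    show "Ck_on k S (\<lambda>p. L (frechet_derivative f (at p) i))"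
      using Suc.prems that by (intro Suc.IH) simp
    show "L (frechet_derivative f (at q) i) = frechet_derivative (\<lambda>p. L (f p)) (at q) i"
      if "q \<in> S" for q
      using dird_eq[OF d[OF that], of i] unfolding dird_def by simp
  qed
  moreover have "(\<lambda>p. L (f p)) differentiable (at p)" if "p \<in> S" for p
    using d[OF that] unfolding differentiable_def by blast
  ultimately show ?case by simp
qed

lemma Ck_on_add:
  fixes f g :: "'a::euclidean_space \<Rightarrow> 'b::real_normed_vector"
  assumes "open S" "Ck_on k S f" "Ck_on k S g"
  shows "Ck_on k S (\<lambda>p. f p + g p)"
  using assms(2,3)
proof (induction k arbitrary: f g)
  case 0
  then show ?case by (auto intro: continuous_on_add)
next
  case (Suc k)
  have d: "((\<lambda>p. f p + g p) has_derivative (\<lambda>v. dird v f p + dird v g p)) (at p)"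
    if "p \<in> S" for p
    using Suc.prems that by (intro has_derivative_add has_derivative_dird) auto
  have "Ck_on k S (\<lambda>p. frechet_derivative (\<lambda>p. f p + g p) (at p) i)" if "i \<in> Basis" for i
  proof (rule Ck_on_cong[OF assms(1)])
    show "Ck_on k S (\<lambda>p. frechet_derivative f (at p) i + frechet_derivative g (at p) i)"
      using Suc.prems that by (intro Suc.IH) simp_all
    show "frechet_derivative f (at q) i + frechet_derivative g (at q) i
        = frechet_derivative (\<lambda>p. f p + g p) (at q) i" if "q \<in> S" for q
      using dird_eq[OF d[OF that], of i] unfolding dird_def by simp
  qed
  moreover have "(\<lambda>p. f p + g p) differentiable (at p)" if "p \<in> S" for p
    using d[OF that] unfolding differentiable_def by blast
  ultimately show ?case by simp
qed

lemma Ck_on_zero: "Ck_on k S (\<lambda>p. 0)"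
  by (induction k) auto

lemma Ck_on_sum:
  fixes f :: "'i \<Rightarrow> 'a::euclidean_space \<Rightarrow> 'b::real_normed_vector"
  assumes "open S" "finite I" "\<And>i. i \<in> I \<Longrightarrow> Ck_on k S (f i)"
  shows "Ck_on k S (\<lambda>p. \<Sum>i\<in>I. f i p)"
  using assms(2,3)
  by (induction I rule: finite_induct) (auto intro: Ck_on_add Ck_on_zero assms(1))

lemma smooth_on_compose_linear:
  assumes "open S" "bounded_linear L" "smooth_on S f"
  shows "smooth_on S (\<lambda>p. L (f p))"
  using assms Ck_on_compose_linear unfolding smooth_on_def by blast

lemma smooth_on_differentiable: "smooth_on S f \<Longrightarrow> p \<in> S \<Longrightarrow> f differentiable (at p)"
  unfolding smooth_on_def using Ck_on.simps(2)[of 0 S f] by blast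

lemma smooth_on_continuous: "smooth_on S f \<Longrightarrow> continuous_on S f"
  unfolding smooth_on_def using Ck_on.simps(1)[of S f] by blast

lemma smooth_on_has_derivative:
  "smooth_on S f \<Longrightarrow> p \<in> S \<Longrightarrow> (f has_derivative (\<lambda>v. dird v f p)) (at p)"
  by (simp add: has_derivative_dird smooth_on_differentiable)

lemma smooth_on_linear_dird:
  "smooth_on S f \<Longrightarrow> p \<in> S \<Longrightarrow> linear (\<lambda>v. dird v f p)"
  using smooth_on_has_derivative has_derivative_linear by blast

lemma dird_compose_linear:
  assumes "bounded_linear L" "smooth_on S f" "p \<in> S"
  shows "dird v (\<lambda>p. L (f p)) p = L (dird v f p)"
  by (rule dird_eq[OF bounded_linear.has_derivative[OF assms(1) smooth_on_has_derivative[OF assms(2,3)]]])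

text \<open>\<open>Ck_on\<close> controls derivatives along basis vectors only; linearity in the
  direction reaches every \<open>v\<close>.\<close>

lemma smooth_on_dird:
  fixes f :: "'a::euclidean_space \<Rightarrow> 'b::real_normed_vector"
  assumes "open S" "smooth_on S f"
  shows "smooth_on S (dird v f)"
  unfolding smooth_on_def
proof
  fix k
  have "Ck_on k S (\<lambda>p. \<Sum>i\<in>Basis. (v \<bullet> i) *\<^sub>R dird i f p)"
    using assms(2) unfolding smooth_on_def dird_def
    by (intro Ck_on_sum[OF assms(1)] Ck_on_compose_linear[OF assms(1) bounded_linear_scaleR_right])
       (auto dest: spec[of _ "Suc k"])
  moreover have "(\<Sum>i\<in>Basis. (v \<bullet> i) *\<^sub>R dird i f p) = dird v f p" if "p \<in> S" for p
  proof -
    have "dird v f p = dird (\<Sum>i\<in>Basis. (v \<bullet> i) *\<^sub>R i) f p"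
      by (simp add: euclidean_representation)
    also have "\<dots> = (\<Sum>i\<in>Basis. dird ((v \<bullet> i) *\<^sub>R i) f p)"
      by (rule linear_sum[OF smooth_on_linear_dird[OF assms(2) that]])
    also have "\<dots> = (\<Sum>i\<in>Basis. (v \<bullet> i) *\<^sub>R dird i f p)"
      by (intro sum.cong refl linear_scale[OF smooth_on_linear_dird[OF assms(2) that]])
    finally show ?thesis by simp
  qed
  ultimately show "Ck_on k S (dird v f)"
    by (rule Ck_on_cong[OF assms(1), rotated])
qed

section \<open>Symmetry of second derivatives\<close>

lemma has_real_derivative_along:
  fixes f :: "'a::real_normed_vector \<Rightarrow> real"
  assumes "(f has_derivative f') (at (a + r *\<^sub>R u))"
  shows "((\<lambda>r. f (a + r *\<^sub>R u)) has_real_derivative f' u) (at r)"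
proof -
  have "((\<lambda>r. f (a + r *\<^sub>R u)) has_derivative (\<lambda>h. f' (h *\<^sub>R u))) (at r)"
    by (rule has_derivative_compose[where f="\<lambda>r. a + r *\<^sub>R u" and g=f, OF _ assms]) (auto intro!: derivative_eq_intros)
  then show ?thesis
    using has_derivative_linear[OF assms]
    by (simp add: has_field_derivative_def linear_scale mult_commute_abs)
qed

text \<open>The mean value theorem twice: along \<open>u\<close> for the increment in direction
  \<open>v\<close>, then along \<open>v\<close> for \<open>dird u f\<close>.\<close>

lemma second_difference_mean_value:
  fixes f :: "'a::euclidean_space \<Rightarrow> real"
  assumes S: "open S" "smooth_on S f" and s: "s > 0"
    and inS: "\<And>r r'. 0 \<le> r \<Longrightarrow> r \<le> s \<Longrightarrow> 0 \<le> r' \<Longrightarrow> r' \<le> s \<Longrightarrow> p + r *\<^sub>R u + r' *\<^sub>R v \<in> S"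
  shows "\<exists>r r'. 0 < r \<and> r < s \<and> 0 < r' \<and> r' < s \<and>
    f (p + s *\<^sub>R u + s *\<^sub>R v) - f (p + s *\<^sub>R u) - f (p + s *\<^sub>R v) + f p
      = s * (s * dird v (dird u f) (p + r *\<^sub>R u + r' *\<^sub>R v))"
proof -
  define \<phi> where "\<phi> r = f ((p + s *\<^sub>R v) + r *\<^sub>R u) - f (p + r *\<^sub>R u)" for r
  have "(\<phi> has_real_derivative dird u f ((p + s *\<^sub>R v) + r *\<^sub>R u) - dird u f (p + r *\<^sub>R u)) (at r)"
    if "0 \<le> r" "r \<le> s" for r
    unfolding \<phi>_def
    using inS[OF that, of s] inS[OF that, of 0] s
    by (intro derivative_intros has_real_derivative_along smooth_on_has_derivative[OF S(2)])
       (auto simp: algebra_simps)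
  from MVT2[OF s this] obtain r where r: "0 < r" "r < s" and
    1: "\<phi> s - \<phi> 0 = s * (dird u f ((p + s *\<^sub>R v) + r *\<^sub>R u) - dird u f (p + r *\<^sub>R u))"
    by auto
  have "((\<lambda>r'. dird u f ((p + r *\<^sub>R u) + r' *\<^sub>R v)) has_real_derivative
          dird v (dird u f) ((p + r *\<^sub>R u) + r' *\<^sub>R v)) (at r')"
    if "0 \<le> r'" "r' \<le> s" for r'
    using inS[OF _ _ that, of r] r
    by (intro has_real_derivative_along smooth_on_has_derivative[OF smooth_on_dird[OF S]]) auto
  from MVT2[OF s this] obtain r' where r': "0 < r'" "r' < s" and
    2: "dird u f ((p + r *\<^sub>R u) + s *\<^sub>R v) - dird u f (p + r *\<^sub>R u) =
        s * dird v (dird u f) ((p + r *\<^sub>R u) + r' *\<^sub>R v)"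
    by auto
  show ?thesis
    using 1 2 r r' unfolding \<phi>_def
    by (intro exI[of _ r] exI[of _ r']) (simp add: algebra_simps)
qed

text \<open>The second difference over a small parallelogram is symmetric in its sides and equals
  \<open>s * s\<close> times either mixed derivative at some point inside; continuity at
  \<open>p\<close> then forbids the two values to differ.\<close>

lemma dird_commute_real:
  fixes f :: "'a::euclidean_space \<Rightarrow> real"
  assumes S: "open S" "smooth_on S f" and p: "p \<in> S"
  shows "dird u (dird v f) p = dird v (dird u f) p"
proof (rule ccontr)
  assume ne: "dird u (dird v f) p \<noteq> dird v (dird u f) p"
  \<comment> \<open>Half the gap: two estimates with error below \<open>e\<close> contradict the
    triangle inequality.\<close>
  define e where "e = dist (dird u (dird v f) p) (dird v (dird u f) p) / 2"
  have e: "e > 0" using ne by (simp add: e_def)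
  have "\<exists>\<delta>>0. \<forall>q. dist q p < \<delta> \<longrightarrow> dist (dird a (dird b f) q) (dird a (dird b f) p) < e" for a b
  proof -
    have "isCont (dird a (dird b f)) p"
      using smooth_on_continuous[OF smooth_on_dird[OF S(1) smooth_on_dird[OF S]]] S(1) p
      by (simp add: continuous_on_eq_continuous_at)
    then show ?thesis using e unfolding continuous_at_eps_delta by blast
  qed
  then obtain \<delta>1 \<delta>2 where d1: "\<delta>1 > 0" "\<And>q. dist q p < \<delta>1 \<Longrightarrow>
      dist (dird u (dird v f) q) (dird u (dird v f) p) < e"
    and d2: "\<delta>2 > 0" "\<And>q. dist q p < \<delta>2 \<Longrightarrow>
      dist (dird v (dird u f) q) (dird v (dird u f) p) < e"
    by metis
  obtain \<delta>3 where d3: "\<delta>3 > 0" "\<And>q. dist q p < \<delta>3 \<Longrightarrow> q \<in> S"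
    using S(1) p unfolding open_dist by blast
  define \<delta> where "\<delta> = min \<delta>1 (min \<delta>2 \<delta>3)"
  have \<delta>: "\<delta> > 0" "\<And>q. dist q p < \<delta> \<Longrightarrow> q \<in> S \<and>
      dist (dird u (dird v f) q) (dird u (dird v f) p) < e \<and>
      dist (dird v (dird u f) q) (dird v (dird u f) p) < e"
    using d1 d2 d3 by (auto simp: \<delta>_def)
  \<comment> \<open>Keeps the parallelogram with sides \<open>s *\<^sub>R u\<close> and
    \<open>s *\<^sub>R v\<close> inside the \<delta>-ball; the 1 makes the denominator
    positive.\<close>
  define s where "s = \<delta> / (norm u + norm v + 1)"
  have pos: "norm u + norm v + 1 > 0" by (simp add: add_nonneg_pos)
  have s: "s > 0" "s * (norm u + norm v) < \<delta>"
  proof -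
    show "s > 0" using \<delta>(1) pos by (simp add: s_def)
    then have "s * (norm u + norm v) < s * (norm u + norm v + 1)" by simp
    then show "s * (norm u + norm v) < \<delta>" using pos by (simp add: s_def)
  qed
  have near: "dist (p + r *\<^sub>R u + r' *\<^sub>R v) p < \<delta>" if "0 \<le> r" "r \<le> s" "0 \<le> r'" "r' \<le> s" for r r'
  proof -
    have "dist (p + r *\<^sub>R u + r' *\<^sub>R v) p \<le> r * norm u + r' * norm v"
      using that norm_triangle_ineq[of "r *\<^sub>R u" "r' *\<^sub>R v"] by (simp add: dist_norm)
    also have "\<dots> \<le> s * (norm u + norm v)"
      using that by (simp add: distrib_left add_mono mult_right_mono)
    finally show ?thesis using s by simp
  qed
  have inS: "p + r *\<^sub>R u + r' *\<^sub>R v \<in> S" if "0 \<le> r" "r \<le> s" "0 \<le> r'" "r' \<le> s" for r r'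
    using \<delta>(2)[OF near[OF that]] by (rule conjunct1)
  have swap: "p + r *\<^sub>R v + r' *\<^sub>R u = p + r' *\<^sub>R u + r *\<^sub>R v" for r r'
    by (simp only: ac_simps)
  have inS': "p + r *\<^sub>R v + r' *\<^sub>R u \<in> S" if "0 \<le> r" "r \<le> s" "0 \<le> r'" "r' \<le> s" for r r'
    unfolding swap using that by (intro inS)
  obtain r r' where 1: "0 < r" "r < s" "0 < r'" "r' < s" and
    D1: "f (p + s *\<^sub>R u + s *\<^sub>R v) - f (p + s *\<^sub>R u) - f (p + s *\<^sub>R v) + f p
      = s * (s * dird v (dird u f) (p + r *\<^sub>R u + r' *\<^sub>R v))"
    using second_difference_mean_value[OF S s(1) inS] by blast
  obtain q q' where 2: "0 < q" "q < s" "0 < q'" "q' < s" and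
    D2: "f (p + s *\<^sub>R v + s *\<^sub>R u) - f (p + s *\<^sub>R v) - f (p + s *\<^sub>R u) + f p
      = s * (s * dird u (dird v f) (p + q *\<^sub>R v + q' *\<^sub>R u))"
    using second_difference_mean_value[OF S s(1) inS'] by blast
  have "s * (s * dird v (dird u f) (p + r *\<^sub>R u + r' *\<^sub>R v)) =
      s * (s * dird u (dird v f) (p + q' *\<^sub>R u + q *\<^sub>R v))"
    using D1 D2 unfolding swap by linarith
  then have eq: "dird v (dird u f) (p + r *\<^sub>R u + r' *\<^sub>R v) = dird u (dird v f) (p + q' *\<^sub>R u + q *\<^sub>R v)"
    using s(1) by simp
  have "dist (dird v (dird u f) (p + r *\<^sub>R u + r' *\<^sub>R v)) (dird v (dird u f) p) < e"
    "dist (dird u (dird v f) (p + q' *\<^sub>R u + q *\<^sub>R v)) (dird u (dird v f) p) < e"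
    using \<delta>(2)[OF near[OF 1[THEN less_imp_le]]]
      \<delta>(2)[OF near[OF 2(3,4,1,2)[THEN less_imp_le]]] by simp_all
  then show False
    using dist_triangle3[of "dird u (dird v f) p" "dird v (dird u f) p"
        "dird u (dird v f) (p + q' *\<^sub>R u + q *\<^sub>R v)"]
    unfolding eq e_def by linarith
qed

lemma dird_commute:
  fixes f :: "'a::euclidean_space \<Rightarrow> 'b::euclidean_space"
  assumes S: "open S" "smooth_on S f" and p: "p \<in> S"
  shows "dird u (dird v f) p = dird v (dird u f) p"
proof (rule euclidean_eqI)
  fix b :: 'b
  have L: "bounded_linear (\<lambda>y::'b. y \<bullet> b)" by (rule bounded_linear_inner_left)
  have eq: "dird u (dird v f) p \<bullet> b = dird u (dird v (\<lambda>p. f p \<bullet> b)) p" for u v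
  proof -
    have "dird u (dird v (\<lambda>p. f p \<bullet> b)) p = dird u (\<lambda>p. dird v f p \<bullet> b) p"
      by (rule dird_cong[OF S(1) p]) (rule dird_compose_linear[OF L S(2)])
    then show ?thesis
      using dird_compose_linear[OF L smooth_on_dird[OF S] p] by simp
  qed
  show "dird u (dird v f) p \<bullet> b = dird v (dird u f) p \<bullet> b"
    unfolding eq by (rule dird_commute_real[OF S(1) smooth_on_compose_linear[OF S(1) L S(2)] p])
qed

subsection \<open>Prolongation\<close>

abbreviation dt :: "(base \<Rightarrow> 'b::real_normed_vector) \<Rightarrow> base \<Rightarrow> 'b" where
  "dt \<equiv> dird (1, 0, 0)"
abbreviation dx :: "(base \<Rightarrow> 'b::real_normed_vector) \<Rightarrow> base \<Rightarrow> 'b" where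
  "dx \<equiv> dird (0, 1, 0)"
abbreviation dU :: "real^3 \<Rightarrow> (base \<Rightarrow> 'b::real_normed_vector) \<Rightarrow> base \<Rightarrow> 'b" where
  "dU Y \<equiv> dird (0, 0, Y)"

text \<open>Linearity in the outer direction holds by differentiability; symmetry carries it to the
  inner one.\<close>

lemma linear_dird_inner:
  fixes f :: "'a::euclidean_space \<Rightarrow> 'b::euclidean_space"
  assumes "open S" "smooth_on S f" "p \<in> S"
  shows "linear (\<lambda>v. dird k (dird v f) p)"
  using smooth_on_linear_dird[OF smooth_on_dird[OF assms(1,2)] assms(3), of k]
  by (simp add: dird_commute[OF assms, of k])

lemma dird_0: "smooth_on S f \<Longrightarrow> p \<in> S \<Longrightarrow> dird 0 f p = 0"
  by (rule linear_0[OF smooth_on_linear_dird])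

lemma dU_0: "smooth_on S f \<Longrightarrow> p \<in> S \<Longrightarrow> dU 0 f p = 0"
  using dird_0[of S f p] by (simp add: zero_prod_def)

lemma dird_base_t:
  assumes "smooth_on S f" "p \<in> S"
  shows "dird (1, 0, V) f p = dt f p + dU V f p"
  using linear_add[OF smooth_on_linear_dird[OF assms], of "(1,0,0)" "(0,0,V)"] by simp

lemma dird_base_x:
  assumes "smooth_on S f" "p \<in> S"
  shows "dird (0, 1, V) f p = dx f p + dU V f p"
  using linear_add[OF smooth_on_linear_dird[OF assms], of "(0,1,0)" "(0,0,V)"] by simp

lemma dU_add:
  assumes "smooth_on S f" "p \<in> S"
  shows "dU (V + W) f p = dU V f p + dU W f p"
  using linear_add[OF smooth_on_linear_dird[OF assms], of "(0,0,V)" "(0,0,W)"] by simp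

lemma dU_scaleR:
  assumes "smooth_on S f" "p \<in> S"
  shows "dU (c *\<^sub>R V) f p = c *\<^sub>R dU V f p"
  using linear_scale[OF smooth_on_linear_dird[OF assms], of c "(0,0,V)"] by simp

text \<open>\<open>(0, 1, V)\<close> is the direction of \<open>D\<^sub>x\<close> for jets with
  \<open>U\<^sub>x = V\<close>, and \<open>V\<close> is held fixed in the second
  differentiation.\<close>

lemma dird_base_xx:
  fixes f :: "base \<Rightarrow> 'b::euclidean_space"
  assumes "open S" "smooth_on S f" "p \<in> S"
  shows "dird (0, 1, V) (dird (0, 1, V) f) p
    = dx (dx f) p + 2 *\<^sub>R dx (dU V f) p + dU V (dU V f) p"
proof -
  have "dird (0, 1, V) (dird (0, 1, V) f) p
      = dird (0, 1, V) (dx f) p + dird (0, 1, V) (dU V f) p"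
    using linear_add[OF linear_dird_inner[OF assms], of _ "(0,1,0)" "(0,0,V)"] by simp
  also have "\<dots> = dx (dx f) p + dU V (dx f) p + (dx (dU V f) p + dU V (dU V f) p)"
    by (simp only: dird_base_x[OF smooth_on_dird[OF assms(1,2)] assms(3), of V])
  finally show ?thesis
    using dird_commute[OF assms, of "(0,0,V)" "(0,1,0)"] by (simp add: scaleR_2 algebra_simps)
qed

lemma dird_vec_nth:
  assumes "smooth_on S f" "p \<in> S"
  shows "dird v (\<lambda>p. f p $ a) p = dird v f p $ a"
  by (rule dird_compose_linear[OF bounded_linear_vec_nth assms])

text \<open>In \<open>Dx0 f\<close> both the point and the direction of differentiation vary with
  the jet. Each contributes one term: \<open>dp\<close> moves the point with the direction frozen,
  \<open>dUx\<close> changes the direction.\<close>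

lemma has_derivative_Dx0:
  fixes f :: "base \<Rightarrow> 'b::euclidean_space"
  assumes S: "open S" "smooth_on S f" and p: "p \<in> S"
  shows "(Dx0 f has_derivative
    (\<lambda>(dp, dUt, dUx). dird dp (dird (0, 1, Ux) f) p + dU dUx f p)) (at (p, Ut, Ux))"
proof -
  \<comment> \<open>Expands \<open>U\<^sub>x\<close> in the standard basis: only derivatives in
    fixed directions remain, to which the product rule applies.\<close>
  define g where "g = (\<lambda>(q, Vt::real^3, Y::real^3). dx f q + (\<Sum>b\<in>UNIV. Y $ b *\<^sub>R dU (axis b 1) f q) :: 'b)"
  have sum: "(\<Sum>b\<in>UNIV. Y $ b *\<^sub>R L (0, 0, axis b 1)) = L (0, 0, Y)"
    if "linear L" for Y and L :: "base \<Rightarrow> 'b"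
  proof -
    have lin: "linear (\<lambda>Y. L (0, 0, Y))"
      using linear_add[OF that, of "(0, 0, _)" "(0, 0, _)"] linear_scale[OF that, of _ "(0, 0, _)"]
      by (intro linearI) simp_all
    have "(\<Sum>b\<in>UNIV. Y $ b *\<^sub>R L (0, 0, axis b 1)) = L (0, 0, \<Sum>b\<in>UNIV. Y $ b *\<^sub>R axis b 1)"
      by (simp only: linear_sum[OF lin] linear_scale[OF lin])
    also have "(\<Sum>b\<in>UNIV. Y $ b *\<^sub>R axis b 1) = Y"
      using basis_expansion[of Y] by (simp add: scalar_mult_eq_scaleR)
    finally show ?thesis .
  qed
  have g: "g (q, Vt, Y) = Dx0 f (q, Vt, Y)" if "q \<in> S" for q Vt Y
    using sum[OF smooth_on_linear_dird[OF S(2) that]] dird_base_x[OF S(2) that, of Y]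
    by (simp add: g_def Dx0_def dird_def)
  let ?z = "(p, Ut, Ux)"
  have *: "((\<lambda>z. dird v f (fst z)) has_derivative (\<lambda>h. dird (fst h) (dird v f) p)) (at ?z)" for v
  proof -
    have "(dird v f has_derivative (\<lambda>h. dird h (dird v f) p)) (at (fst ?z))"
      using smooth_on_has_derivative[OF smooth_on_dird[OF S] p] by simp
    from has_derivative_compose[OF has_derivative_fst[OF has_derivative_ident] this]
    show ?thesis .
  qed
  have nth: "((\<lambda>z. snd (snd z) $ b) has_derivative (\<lambda>h. snd (snd h) $ b)) (at ?z)" for b :: 3
    by (intro bounded_linear.has_derivative[OF bounded_linear_vec_nth]
        has_derivative_snd has_derivative_ident)
  have "((\<lambda>z. dx f (fst z) + (\<Sum>b\<in>UNIV. snd (snd z) $ b *\<^sub>R dU (axis b 1) f (fst z)))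
    has_derivative (\<lambda>h. dird (fst h) (dx f) p +
      (\<Sum>b\<in>UNIV. snd (snd ?z) $ b *\<^sub>R dird (fst h) (dU (axis b 1) f) p
        + snd (snd h) $ b *\<^sub>R dU (axis b 1) f (fst ?z)))) (at ?z)"
    by (intro has_derivative_add has_derivative_sum has_derivative_scaleR * nth)
  then have "(g has_derivative (\<lambda>(dp, dUt, dUx). dird dp (dx f) p +
      (\<Sum>b\<in>UNIV. Ux $ b *\<^sub>R dird dp (dU (axis b 1) f) p + dUx $ b *\<^sub>R dU (axis b 1) f p)))
      (at ?z)"
    by (simp add: g_def case_prod_unfold)
  then have "(Dx0 f has_derivative (\<lambda>(dp, dUt, dUx). dird dp (dx f) p +
      (\<Sum>b\<in>UNIV. Ux $ b *\<^sub>R dird dp (dU (axis b 1) f) p + dUx $ b *\<^sub>R dU (axis b 1) f p)))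
      (at (p, Ut, Ux))"
    by (rule has_derivative_transform_within_open[where s="S \<times> UNIV"])
       (use S p g in \<open>auto intro: open_Times\<close>)
  moreover have "dird dp (dx f) p +
      (\<Sum>b\<in>UNIV. Ux $ b *\<^sub>R dird dp (dU (axis b 1) f) p + dUx $ b *\<^sub>R dU (axis b 1) f p)
    = dird dp (dird (0, 1, Ux) f) p + dU dUx f p" for dp dUx
    using sum[OF smooth_on_linear_dird[OF S(2) p]] sum[OF linear_dird_inner[OF S p]]
      linear_add[OF linear_dird_inner[OF S p], of _ "(0,1,0)" "(0,0,Ux)"]
    by (simp add: sum.distrib)
  ultimately show ?thesis by simp
qed

text \<open>Of each factor 2, one summand comes from the product rule in
  \<open>D\<^sub>x \<zeta>\<^sub>x\<close>, the other from the correction term in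
  \<open>\<zeta>\<^sub>x\<^sub>x\<close>.\<close>

lemma zeta_xx_eq:
  fixes X :: "base \<Rightarrow> base" and Ux
  defines "h \<equiv> (0, 1, Ux)"
  assumes D: "open D" and S: "smooth_on D (xi0 X)" "smooth_on D (xi1 X)" "smooth_on D (eta X)"
    and p: "p \<in> D"
  shows "zeta_xx X ((p, Ut, Ux), Utt, Utx, Uxx) =
    dird h (dird h (eta X)) p + dU Uxx (eta X) p
    - (dird h (dird h (xi0 X)) p + dU Uxx (xi0 X) p) *\<^sub>R Ut - (2 * dird h (xi0 X) p) *\<^sub>R Utx
    - (dird h (dird h (xi1 X)) p + dU Uxx (xi1 X) p) *\<^sub>R Ux - (2 * dird h (xi1 X) p) *\<^sub>R Uxx"
proof -
  let ?z = "(p, Ut, Ux)"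
  have Z: "zeta_x X = (\<lambda>z. Dx0 (eta X) z - Dx0 (xi0 X) z *\<^sub>R fst (snd z) - Dx0 (xi1 X) z *\<^sub>R snd (snd z))"
    by (simp add: fun_eq_iff zeta_x_def Let_def case_prod_unfold)
  have Dx0: "(Dx0 f has_derivative (\<lambda>k. dird (fst k) (dird h f) p + dU (snd (snd k)) f p)) (at ?z)"
    if "smooth_on D f" for f :: "base \<Rightarrow> 'b::euclidean_space"
    using has_derivative_Dx0[OF D that p, of Ux Ut] by (simp add: case_prod_unfold h_def)
  have "(zeta_x X has_derivative (\<lambda>k.
      (dird (fst k) (dird h (eta X)) p + dU (snd (snd k)) (eta X) p)
      - (Dx0 (xi0 X) ?z *\<^sub>R fst (snd k)
         + (dird (fst k) (dird h (xi0 X)) p + dU (snd (snd k)) (xi0 X) p) *\<^sub>R fst (snd ?z))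
      - (Dx0 (xi1 X) ?z *\<^sub>R snd (snd k)
         + (dird (fst k) (dird h (xi1 X)) p + dU (snd (snd k)) (xi1 X) p) *\<^sub>R snd (snd ?z)))) (at ?z)"
    unfolding Z
    by (rule has_derivative_diff has_derivative_scaleR Dx0 S
        has_derivative_fst has_derivative_snd has_derivative_ident)+
  from dird_eq[OF this, of "((0,1,Ux),Utx,Uxx)"]
  have Dx1: "Dx1 (zeta_x X) (?z, Utt, Utx, Uxx) =
      (dird h (dird h (eta X)) p + dU Uxx (eta X) p)
      - (dird h (xi0 X) p *\<^sub>R Utx + (dird h (dird h (xi0 X)) p + dU Uxx (xi0 X) p) *\<^sub>R Ut)
      - (dird h (xi1 X) p *\<^sub>R Uxx + (dird h (dird h (xi1 X)) p + dU Uxx (xi1 X) p) *\<^sub>R Ux)"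
    unfolding Dx1_def Dx0_def dird_def h_def prod.case fst_conv snd_conv .
  have Dx0': "Dx0 f ?z = dird h f p" for f :: "base \<Rightarrow> real"
    by (simp add: Dx0_def dird_def h_def)
  show ?thesis
    unfolding zeta_xx_def prod.case Dx1 Dx0' mult_2 scaleR_add_left by (simp only: algebra_simps)
qed

subsection \<open>Determining equations of a reaction-diffusion system\<close>

lemma dird_zero_on:
  assumes "open S" "p \<in> S" "\<And>q. q \<in> S \<Longrightarrow> f q = 0"
  shows "dird v f p = 0"
  using dird_cong[OF assms(1,2), of f "\<lambda>_. 0" v] assms(3) by (simp add: dird_def)

text \<open>\<open>*\<close> on \<open>real^3\<close> is componentwise, so \<open>d\<close> stands
  for a diagonal diffusion matrix; \<open>R'\<close> stands for the Jacobian of \<open>R\<close>. In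
  \<open>invariant\<close> the coordinate \<open>U\<^sub>t\<close> is eliminated by the system; the
  other derivative coordinates stay free, and the determining equations come from comparing
  coefficients in them.\<close>

locale rd_symmetry =
  fixes D :: "base set" and X :: "base \<Rightarrow> base" and d :: "real^3"
    and R :: "real^3 \<Rightarrow> real^3" and R' :: "real^3 \<Rightarrow> real^3 \<Rightarrow> real^3"
  assumes open_D: "open D" and smooth_X: "smooth_on D X" and d_pos: "\<And>a. d $ a > 0"
    and invariant: "\<And>t x U Ux Utt Utx Uxx. (t, x, U) \<in> D \<Longrightarrow>
      zeta_t X ((t, x, U), d * Uxx + R U, Ux)
        = d * zeta_xx X (((t, x, U), d * Uxx + R U, Ux), Utt, Utx, Uxx) + R' U (eta X (t, x, U))"
begin

lemma smooth_xi0: "smooth_on D (xi0 X)"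
  using smooth_on_compose_linear[OF open_D bounded_linear_fst smooth_X]
  by (simp add: xi0_def[abs_def])

lemma smooth_xi1: "smooth_on D (xi1 X)"
  using smooth_on_compose_linear[OF open_D bounded_linear_compose[OF bounded_linear_fst bounded_linear_snd] smooth_X]
  by (simp add: xi1_def[abs_def])

lemma smooth_eta: "smooth_on D (eta X)"
  using smooth_on_compose_linear[OF open_D bounded_linear_compose[OF bounded_linear_snd bounded_linear_snd] smooth_X]
  by (simp add: eta_def[abs_def])

lemmas smooth_coeffs = smooth_xi0 smooth_xi1 smooth_eta
lemmas smooth_coeffs1 = smooth_coeffs[THEN smooth_on_dird[OF open_D]]

text \<open>\<open>Y\<close>, \<open>W\<close>, \<open>Z\<close> are the free coordinates
  \<open>U\<^sub>x\<close>, \<open>U\<^sub>x\<^sub>x\<close>, \<open>U\<^sub>t\<^sub>x\<close>;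
  \<open>V\<close> is the value of \<open>U\<^sub>t\<close> on the system.\<close>

lemma invariant_expanded:
  fixes U W Y Z :: "real^3"
  assumes p: "(t, x, U) \<in> D"
  defines "p \<equiv> (t, x, U)" and "h \<equiv> (0, 1, Y)" and "V \<equiv> d * W + R U"
  shows "dird (1, 0, V) (eta X) p - dird (1, 0, V) (xi0 X) p *\<^sub>R V - dird (1, 0, V) (xi1 X) p *\<^sub>R Y =
    d * (dird h (dird h (eta X)) p + dU W (eta X) p
      - (dird h (dird h (xi0 X)) p + dU W (xi0 X) p) *\<^sub>R V - (2 * dird h (xi0 X) p) *\<^sub>R Z
      - (dird h (dird h (xi1 X)) p + dU W (xi1 X) p) *\<^sub>R Y - (2 * dird h (xi1 X) p) *\<^sub>R W)
    + R' U (eta X p)"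
  \<comment> \<open>\<open>U\<^sub>t\<^sub>t\<close> drops out of \<open>zeta_xx\<close>, so any
    value serves.\<close>
  using invariant[OF p, of W Y undefined Z]
  unfolding p_def h_def V_def zeta_xx_eq[OF open_D smooth_coeffs p]
  by (simp add: zeta_t_def Dt0_def dird_def Let_def)

text \<open>\<open>Z\<close> enters only through the term with factor
  \<open>2 D\<^sub>x \<xi>\<^sup>0\<close>; since \<open>d $ 1 > 0\<close>, the instances
  \<open>Z = e\<^sub>1\<close> and \<open>Z = 0\<close> force that factor to vanish.\<close>

lemma xi0_h:
  assumes "p \<in> D"
  shows "dird (0, 1, Y) (xi0 X) p = 0"
proof -
  obtain t x U where p: "p = (t, x, U)" by (cases p)
  have key: "c = 0" if "\<And>Z. L = d * (A - c *\<^sub>R Z - B - C) + r" for L A B C r c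
  proof -
    have "d * (A - c *\<^sub>R axis 1 1 - B - C) + r = d * (A - c *\<^sub>R 0 - B - C) + r"
      using that by metis
    then have "d $ 1 * (A $ 1 - c - B $ 1 - C $ 1) = d $ 1 * (A $ 1 - B $ 1 - C $ 1)"
      by (auto dest!: arg_cong[where f="\<lambda>v. v $ 1"])
    then show ?thesis using d_pos[of 1] by simp
  qed
  have "2 * dird (0, 1, Y) (xi0 X) p = 0"
    by (rule key, unfold p, rule invariant_expanded[OF assms[unfolded p], of 0 Y])
  then show ?thesis by simp
qed

lemma xi0_x: "p \<in> D \<Longrightarrow> dx (xi0 X) p = 0"
  by (rule xi0_h)

lemma xi0_U:
  assumes "p \<in> D"
  shows "dU Y (xi0 X) p = 0"
  using xi0_h[OF assms, of Y] unfolding dird_base_x[OF smooth_xi0 assms, of Y] xi0_x[OF assms] by simp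

text \<open>With \<open>D\<^sub>x \<xi>\<^sup>0 = 0\<close> the terms in \<open>Z\<close> are gone;
  splitting \<open>dU\<close> over \<open>d * W + R U\<close> exposes the dependence on
  \<open>W\<close>.\<close>

lemma invariant_reduced:
  fixes U W Y :: "real^3"
  assumes p: "(t, x, U) \<in> D"
  defines "p \<equiv> (t, x, U)" and "h \<equiv> (0, 1, Y)"
  shows "dt (eta X) p + dU (d * W) (eta X) p + dU (R U) (eta X) p - dt (xi0 X) p *\<^sub>R (d * W + R U)
      - (dt (xi1 X) p + dU (d * W) (xi1 X) p + dU (R U) (xi1 X) p) *\<^sub>R Y =
    d * (dird h (dird h (eta X)) p + dU W (eta X) p
      - (dird h (dird h (xi1 X)) p + dU W (xi1 X) p) *\<^sub>R Y
      - (2 * (dx (xi1 X) p + dU Y (xi1 X) p)) *\<^sub>R W)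
    + R' U (eta X p)"
proof -
  have pD: "p \<in> D" using p by (simp add: p_def)
  have 0: "dird h (dird h (xi0 X)) p = 0"
    unfolding h_def by (rule dird_zero_on[OF open_D pD xi0_h])
  have dt: "dird (1, 0, d * W + R U) f p = dt f p + dU (d * W) f p + dU (R U) f p"
    if "smooth_on D f" for f :: "base \<Rightarrow> 'b::euclidean_space"
    by (simp only: dird_base_t[OF that pD, of "d * W + R U"] dU_add[OF that pD] add.assoc)
  have dh: "dird h (xi1 X) p = dx (xi1 X) p + dU Y (xi1 X) p"
    unfolding h_def by (rule dird_base_x[OF smooth_xi1 pD])
  show ?thesis
    using invariant_expanded[OF p, of W Y 0]
    unfolding p_def[symmetric] h_def[symmetric] 0 dh dt[OF smooth_eta] dt[OF smooth_xi1]
      dird_base_t[OF smooth_xi0 pD, of "d * W + R U"] xi0_U[OF pD]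
    by simp
qed

text \<open>The coefficient of \<open>W\<close>, read off in the first component from
  \<open>W = e\<^sub>1\<close> and \<open>W = 0\<close>. As \<open>d * e\<^sub>1\<close> is
  \<open>d $ 1\<close> times \<open>e\<^sub>1\<close>, the terms in \<open>\<eta>\<^sub>U\<close>
  and \<open>\<xi>\<^sup>1\<^sub>U\<close> cancel even when the diffusivities differ.\<close>

lemma xi0_t_h:
  assumes "p \<in> D"
  shows "dt (xi0 X) p = 2 * (dx (xi1 X) p + dU Y (xi1 X) p)"
proof -
  obtain t x U where p: "p = (t, x, U)" by (cases p)
  have d1: "d * axis 1 1 = d $ 1 *\<^sub>R axis 1 (1::real)"
    by (simp add: vec_eq_iff axis_def)
  \<comment> \<open>\<open>N\<close> and \<open>n\<close> are the derivatives of
    \<open>\<eta>\<close> and \<open>\<xi>\<^sup>1\<close> along \<open>e\<^sub>1\<close>; \<tau> is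
    \<open>\<xi>\<^sup>0\<^sub>t\<close>.\<close>
  have key: "\<tau> = c"
    if "L + d $ 1 *\<^sub>R N + r - \<tau> *\<^sub>R (d $ 1 *\<^sub>R axis 1 1 + \<rho>) - (s + d $ 1 *\<^sub>R n + s') *\<^sub>R Y
        = d * (H + N - (k + n) *\<^sub>R Y - c *\<^sub>R axis 1 1) + r'"
      and "L + 0 + r - \<tau> *\<^sub>R (0 + \<rho>) - (s + 0 + s') *\<^sub>R Y
        = d * (H + 0 - (k + 0) *\<^sub>R Y - c *\<^sub>R 0) + r'"
    for L N r \<rho> H r' :: "real^3" and \<tau> s n s' k c :: real
  proof -
    have "L $ 1 + d $ 1 * N $ 1 + r $ 1 - \<tau> * (d $ 1 + \<rho> $ 1) - (s + d $ 1 * n + s') * Y $ 1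
        = d $ 1 * (H $ 1 + N $ 1 - (k + n) * Y $ 1 - c) + r' $ 1"
      using that(1)[THEN arg_cong[where f="\<lambda>v. v $ 1"]] by simp
    moreover have "L $ 1 + r $ 1 - \<tau> * \<rho> $ 1 - (s + s') * Y $ 1
        = d $ 1 * (H $ 1 - k * Y $ 1) + r' $ 1"
      using that(2)[THEN arg_cong[where f="\<lambda>v. v $ 1"]] by simp
    ultimately have "d $ 1 * \<tau> = d $ 1 * c" by algebra
    then show ?thesis using d_pos[of 1] by simp
  qed
  note * = invariant_reduced[OF assms[unfolded p], folded p, of _ Y]
  show ?thesis
    by (rule key[OF *[of "axis 1 1", unfolded d1 dU_scaleR[OF smooth_eta assms] dU_scaleR[OF smooth_xi1 assms]]
          *[of 0, unfolded mult_zero_right dU_0[OF smooth_eta assms] dU_0[OF smooth_xi1 assms]]])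
qed

text \<open>The left side of \<open>xi0_t_h\<close> is free of \<open>Y\<close>.\<close>

lemma xi1_U: "p \<in> D \<Longrightarrow> dU Y (xi1 X) p = 0"
  using xi0_t_h[of p Y] xi0_t_h[of p 0] dU_0[OF smooth_xi1, of p] by simp

lemma xi0_t: "p \<in> D \<Longrightarrow> dt (xi0 X) p = 2 * dx (xi1 X) p"
  using xi0_t_h[of p 0] xi1_U[of p 0] by simp

text \<open>By \<open>xi0_t\<close> this is half the \<open>x\<close>-derivative of
  \<open>\<xi>\<^sup>0\<^sub>t\<close>, and \<open>\<xi>\<^sup>0\<close> does not depend on
  \<open>x\<close>.\<close>

lemma xi1_xx:
  assumes "p \<in> D"
  shows "dx (dx (xi1 X)) p = 0"
proof -
  have "2 * dx (dx (xi1 X)) p = dx (\<lambda>p. 2 * dx (xi1 X) p) p"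
    using dird_compose_linear[OF bounded_linear_mult_right[of 2] smooth_coeffs1(2) assms] by metis
  also have "\<dots> = dx (dt (xi0 X)) p"
    by (rule dird_cong[OF open_D assms]) (simp add: xi0_t)
  also have "\<dots> = dt (dx (xi0 X)) p"
    by (rule dird_commute[OF open_D smooth_xi0 assms])
  also have "\<dots> = 0"
    by (rule dird_zero_on[OF open_D assms xi0_x])
  finally show ?thesis by simp
qed

text \<open>The part at \<open>W = 0\<close> is a quadratic polynomial in \<open>Y\<close>, whose
  constant, linear and quadratic terms are separated next.\<close>

lemma invariant_gradient:
  fixes U Y :: "real^3"
  assumes p: "(t, x, U) \<in> D"
  defines "p \<equiv> (t, x, U)"
  shows "dt (eta X) p + dU (R U) (eta X) p - dt (xi0 X) p *\<^sub>R R U - dt (xi1 X) p *\<^sub>R Y =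
    d * (dx (dx (eta X)) p + 2 *\<^sub>R dx (dU Y (eta X)) p + dU Y (dU Y (eta X)) p)
    + R' U (eta X p)"
proof -
  have pD: "p \<in> D" using p by (simp add: p_def)
  have "dird v (dU Y (xi1 X)) p = 0" for v
    by (rule dird_zero_on[OF open_D pD]) (rule xi1_U)
  then have 0: "dird (0, 1, Y) (dird (0, 1, Y) (xi1 X)) p = 0"
    unfolding dird_base_xx[OF open_D smooth_xi1 pD, of Y] by (simp add: xi1_xx[OF pD])
  show ?thesis
    using invariant_reduced[OF p, of 0 Y]
    unfolding p_def[symmetric] 0 xi1_U[OF pD] dird_base_xx[OF open_D smooth_eta pD, of Y]
      mult_zero_right dU_0[OF smooth_eta pD]
    by simp
qed

lemma invariant_rest:
  assumes p: "(t, x, U) \<in> D"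
  defines "p \<equiv> (t, x, U)"
  shows "dt (eta X) p + dU (R U) (eta X) p - dt (xi0 X) p *\<^sub>R R U
    = d * dx (dx (eta X)) p + R' U (eta X p)"
proof -
  have pD: "p \<in> D" using p by (simp add: p_def)
  have "dx (dU 0 (eta X)) p = 0" "dU 0 (dU 0 (eta X)) p = 0"
    using linear_0[OF linear_dird_inner[OF open_D smooth_eta pD]] by (simp_all add: zero_prod_def)
  then show ?thesis
    using invariant_gradient[OF p, of 0] unfolding p_def[symmetric] by simp
qed

lemma eta_scaled:
  assumes "p \<in> D"
  shows "- dt (xi1 X) p *\<^sub>R Y = d * (2 *\<^sub>R dx (dU Y (eta X)) p + dU Y (dU Y (eta X)) p)"
proof -
  obtain t x U where p: "p = (t, x, U)" by (cases p)
  have key: "- c *\<^sub>R Y = d * (M + N)"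
    if "A - c *\<^sub>R Y = d * (H + M + N) + r" "A = d * H + r" for A H M N r c
  proof -
    have "- c *\<^sub>R Y = (A - c *\<^sub>R Y) - A" by simp
    also have "\<dots> = d * (H + M + N) + r - A" by (simp only: that(1))
    also have "\<dots> = d * (M + N)" by (simp add: that(2) algebra_simps)
    finally show ?thesis .
  qed
  show ?thesis
    unfolding p
    by (rule key[OF invariant_gradient[OF assms[unfolded p]] invariant_rest[OF assms[unfolded p]]])
qed

text \<open>Passing from \<open>Y\<close> to \<open>-Y\<close> in \<open>eta_scaled\<close> isolates
  the even part.\<close>

lemma eta_UU_diag:
  assumes "p \<in> D"
  shows "dU Y (dU Y (eta X)) p = 0"
proof -
  have L: "linear (\<lambda>v. dird k (dird v (eta X)) p)" "linear (\<lambda>v. dird v (dird k (eta X)) p)" for k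
    by (rule linear_dird_inner[OF open_D smooth_eta assms] smooth_on_linear_dird[OF smooth_coeffs1(3) assms])+
  have neg: "dx (dU (-Y) (eta X)) p = - dx (dU Y (eta X)) p"
    "dU (-Y) (dU (-Y) (eta X)) p = dU Y (dU Y (eta X)) p"
    using linear_neg[OF L(1), of "(0,1,0)" "(0,0,Y)"] linear_neg[OF L(1), of "(0,0,-Y)" "(0,0,Y)"]
      linear_neg[OF L(2), of "(0,0,Y)" "(0,0,Y)"] by simp_all
  have "dU Y (dU Y (eta X)) p $ a = 0" for a
  proof -
    note * = eta_scaled[OF assms, THEN arg_cong[where f="\<lambda>v. v $ a"]]
    have "- dt (xi1 X) p * Y $ a
        = d $ a * (2 * dx (dU Y (eta X)) p $ a + dU Y (dU Y (eta X)) p $ a)"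
      using *[of Y] by simp
    moreover have "dt (xi1 X) p * Y $ a
        = d $ a * (- 2 * dx (dU Y (eta X)) p $ a + dU Y (dU Y (eta X)) p $ a)"
      using *[of "- Y"] unfolding neg by simp
    ultimately have "2 * (d $ a * dU Y (dU Y (eta X)) p $ a) = 0" by algebra
    then show ?thesis using d_pos[of a] by simp
  qed
  then show ?thesis by (simp add: vec_eq_iff)
qed

text \<open>Polarisation of \<open>eta_UU_diag\<close>.\<close>

lemma eta_UU:
  assumes "p \<in> D"
  shows "dU Y (dU Z (eta X)) p = 0"
proof -
  have "dU (Y + Z) (dU (Y + Z) (eta X)) p = dU (Y + Z) (dU Y (eta X)) p + dU (Y + Z) (dU Z (eta X)) p"
    using linear_add[OF linear_dird_inner[OF open_D smooth_eta assms], of _ "(0,0,Y)" "(0,0,Z)"] by simp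
  also have "\<dots> = dU Y (dU Y (eta X)) p + dU Z (dU Y (eta X)) p
      + (dU Y (dU Z (eta X)) p + dU Z (dU Z (eta X)) p)"
    by (simp only: dU_add[OF smooth_coeffs1(3) assms])
  finally have "dU Z (dU Y (eta X)) p + dU Y (dU Z (eta X)) p = 0"
    by (simp add: eta_UU_diag[OF assms])
  then have "2 *\<^sub>R dU Y (dU Z (eta X)) p = 0"
    using dird_commute[OF open_D smooth_eta assms, of "(0,0,Z)" "(0,0,Y)"] by (simp add: scaleR_2)
  then show ?thesis by simp
qed

lemma eta_xU: "p \<in> D \<Longrightarrow> d * (2 *\<^sub>R dx (dU Y (eta X)) p) = - dt (xi1 X) p *\<^sub>R Y"
  using eta_scaled[of p Y] eta_UU[of p Y Y] by simp

end

subsection \<open>Quadratic reaction terms\<close>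

text \<open>Point and direction vary together, as in \<open>Dx0\<close>; writing
  \<open>dU (G p) f p\<close> as \<open>Dx0 f (p, 0, G p) - dx f p\<close> reduces the claim to
  \<open>has_derivative_Dx0\<close>.\<close>

lemma has_derivative_dU_field:
  fixes f :: "base \<Rightarrow> 'b::euclidean_space"
  assumes S: "open S" "smooth_on S f" and p: "p \<in> S" and G: "(G has_derivative G') (at p)"
  shows "((\<lambda>p. dU (G p) f p) has_derivative (\<lambda>k. dird k (dU (G p) f) p + dU (G' k) f p)) (at p)"
proof -
  have "(Dx0 f has_derivative (\<lambda>k. dird (fst k) (dird (0, 1, G p) f) p + dU (snd (snd k)) f p))
      (at (p, 0, G p))"
    using has_derivative_Dx0[OF S p, of "G p" 0] by (simp add: case_prod_unfold)
  from has_derivative_compose[OF has_derivative_Pair[OF has_derivative_ident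
        has_derivative_Pair[OF has_derivative_const G]] this]
  have "((\<lambda>p. Dx0 f (p, 0, G p)) has_derivative
      (\<lambda>k. dird k (dird (0, 1, G p) f) p + dU (G' k) f p)) (at p)"
    by simp
  from has_derivative_diff[OF this smooth_on_has_derivative[OF smooth_on_dird[OF S] p, of "(0,1,0)"]]
  have "((\<lambda>p. Dx0 f (p, 0, G p) - dx f p) has_derivative
      (\<lambda>k. dird k (dU (G p) f) p + dU (G' k) f p)) (at p)"
    using linear_add[OF linear_dird_inner[OF S p], of _ "(0,1,0)" "(0,0,G p)"] by simp
  then show ?thesis
  proof (rule has_derivative_transform_within_open[OF _ S(1) p])
    fix q assume "q \<in> S"
    then show "Dx0 f (q, 0, G q) - dx f q = dU (G q) f q"
      using dird_base_x[OF S(2), of q "G q"] by (simp add: Dx0_def dird_def)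
  qed
qed

lemma has_derivative_eq_on:
  assumes "open S" "p \<in> S" "\<And>q. q \<in> S \<Longrightarrow> f q = g q"
    and "(f has_derivative f') (at p)" "(g has_derivative g') (at p)"
  shows "f' v = g' v"
  using has_derivative_unique[OF has_derivative_transform_within_open[OF assms(4,1,2,3)] assms(5)]
  by simp

text \<open>The factor 1/2 makes \<open>B\<close> the second derivative of the reaction term; by
  symmetry of \<open>B\<close> the Jacobian is then \<open>L V + B U V\<close>.\<close>

locale rd_quadratic =
  rd_symmetry D X d "\<lambda>U. L U + (1/2) *\<^sub>R B U U" "\<lambda>U V. L V + B U V"
  for D X d and L :: "real^3 \<Rightarrow> real^3" and B :: "real^3 \<Rightarrow> real^3 \<Rightarrow> real^3" +
  assumes L: "bounded_linear L" and B: "bounded_bilinear B" and B_commute: "\<And>Y Z. B Y Z = B Z Y"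
    and no_derivation: "\<And>M Y. linear M \<Longrightarrow>
      (\<And>Y Z. M (B Z Y) = B Y (M Z) + B Z (M Y)) \<Longrightarrow> M Y = 0"
begin

section \<open>Differentiating the last determining equation in \<open>U\<close>\<close>

lemma xi1_xt:
  assumes "p \<in> D"
  shows "dx (dt (xi1 X)) p = dt (dt (xi0 X)) p / 2"
proof -
  have "dt (dt (xi0 X)) p = dt (\<lambda>p. 2 * dx (xi1 X) p) p"
    by (rule dird_cong[OF open_D assms]) (rule xi0_t)
  also have "\<dots> = 2 * dt (dx (xi1 X)) p"
    by (rule dird_compose_linear[OF bounded_linear_mult_right smooth_coeffs1(2) assms])
  finally show ?thesis
    using dird_commute[OF open_D smooth_xi1 assms, of "(0,1,0)" "(1,0,0)"] by simp
qed

text \<open>The \<open>x\<close>-derivative of \<open>eta_xU\<close>; of the factor 1/4, one half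
  stems from \<open>eta_xU\<close> and the other from \<open>xi1_xt\<close>.\<close>

lemma eta_xxU:
  assumes "p \<in> D"
  shows "d * dU Y (dx (dx (eta X))) p = - (dt (dt (xi0 X)) p / 4) *\<^sub>R Y"
proof -
  have bl: "bounded_linear (\<lambda>v. d * (2 *\<^sub>R v))"
    by (rule linear_conv_bounded_linear[THEN iffD1])
       (rule linearI; simp add: vec_eq_iff algebra_simps)
  have "dU Y (dx (dx (eta X))) p = dx (dU Y (dx (eta X))) p"
    by (rule dird_commute[OF open_D smooth_coeffs1(3) assms])
  also have "\<dots> = dx (dx (dU Y (eta X))) p"
    by (rule dird_cong[OF open_D assms]) (rule dird_commute[OF open_D smooth_eta])
  finally have "d * (2 *\<^sub>R dU Y (dx (dx (eta X))) p) = d * (2 *\<^sub>R dx (dx (dU Y (eta X))) p)"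
    by simp
  also have "\<dots> = dx (\<lambda>p. d * (2 *\<^sub>R dx (dU Y (eta X)) p)) p"
    by (rule dird_compose_linear[OF bl smooth_on_dird[OF open_D smooth_coeffs1(3)] assms, symmetric])
  also have "\<dots> = dx (\<lambda>p. dt (xi1 X) p *\<^sub>R - Y) p"
    by (rule dird_cong[OF open_D assms]) (simp only: eta_xU scaleR_minus_left scaleR_minus_right)
  also have "\<dots> = dx (dt (xi1 X)) p *\<^sub>R - Y"
    by (rule dird_compose_linear[OF bounded_linear_scaleR_left smooth_coeffs1(2) assms])
  finally have "2 * (d $ i * dU Y (dx (dx (eta X))) p $ i) = - (dt (dt (xi0 X)) p * Y $ i / 2)" for i
    by (simp add: xi1_xt[OF assms] vec_eq_iff)
  then have "d $ i * dU Y (dx (dx (eta X))) p $ i = - (dt (dt (xi0 X)) p * Y $ i / 4)" for i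
    by (simp add: field_simps)
  then show ?thesis by (simp add: vec_eq_iff)
qed

lemma has_derivative_U: "((\<lambda>p. snd (snd p)) has_derivative (\<lambda>k. snd (snd k))) (at p)"
  by (intro has_derivative_snd has_derivative_ident)

text \<open>\<open>invariant_rest\<close> differentiated in \<open>U\<close> along \<open>Y\<close>.
  As \<open>\<eta>\<close> is affine in \<open>U\<close> and \<open>\<xi>\<^sup>0\<close> free of
  \<open>U\<close>, no second \<open>U\<close>-derivative survives.\<close>

lemma invariant_U:
  assumes p: "(t, x, U) \<in> D"
  defines "p \<equiv> (t, x, U)"
  shows "dt (dU Y (eta X)) p + dU (L Y + B U Y) (eta X) p - dt (xi0 X) p *\<^sub>R (L Y + B U Y)
    = - (dt (dt (xi0 X)) p / 4) *\<^sub>R Y + B Y (eta X p) + (L (dU Y (eta X) p) + B U (dU Y (eta X) p))"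
proof -
  have pD: "p \<in> D" using p by (simp add: p_def)
  let ?U = "\<lambda>p::base. snd (snd p)"
  let ?G = "\<lambda>p. L (?U p) + (1/2) *\<^sub>R B (?U p) (?U p)"
  have G: "(?G has_derivative (\<lambda>k. L (?U k) + (1/2) *\<^sub>R (B (?U p) (?U k) + B (?U k) (?U p)))) (at p)"
    by (intro has_derivative_add has_derivative_scaleR_right bounded_bilinear.FDERIV[OF B]
        bounded_linear.has_derivative[OF L] has_derivative_U)
  have bl: "bounded_linear (\<lambda>v. d * v)"
    by (rule linear_conv_bounded_linear[THEN iffD1])
       (rule linearI; simp add: vec_eq_iff algebra_simps)
  note hd = smooth_on_has_derivative[OF _ pD]
  have lhs: "((\<lambda>p. dt (eta X) p + dU (?G p) (eta X) p - dt (xi0 X) p *\<^sub>R ?G p) has_derivative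
    (\<lambda>k. dird k (dt (eta X)) p + (dird k (dU (?G p) (eta X)) p
        + dU (L (?U k) + (1/2) *\<^sub>R (B (?U p) (?U k) + B (?U k) (?U p))) (eta X) p)
      - (dt (xi0 X) p *\<^sub>R (L (?U k) + (1/2) *\<^sub>R (B (?U p) (?U k) + B (?U k) (?U p)))
         + dird k (dt (xi0 X)) p *\<^sub>R ?G p))) (at p)"
    by (intro has_derivative_add has_derivative_diff has_derivative_scaleR hd smooth_coeffs1
        has_derivative_dU_field[OF open_D smooth_eta pD] G)
  have rhs: "((\<lambda>p. d * dx (dx (eta X)) p + (L (eta X p) + B (?U p) (eta X p))) has_derivative
    (\<lambda>k. d * dird k (dx (dx (eta X))) p + (L (dird k (eta X) p)
      + (B (?U p) (dird k (eta X) p) + B (?U k) (eta X p))))) (at p)"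
    by (intro has_derivative_add bounded_linear.has_derivative[OF bl] bounded_linear.has_derivative[OF L]
        bounded_bilinear.FDERIV[OF B] has_derivative_U hd smooth_on_dird[OF open_D] smooth_coeffs)
  have eq: "dt (eta X) q + dU (?G q) (eta X) q - dt (xi0 X) q *\<^sub>R ?G q
      = d * dx (dx (eta X)) q + (L (eta X q) + B (?U q) (eta X q))" if "q \<in> D" for q
    using invariant_rest[of "fst q" "fst (snd q)" "?U q"] that by simp
  have "dU Y (dt (eta X)) p + (dU Y (dU (?G p) (eta X)) p
        + dU (L Y + (1/2) *\<^sub>R (B U Y + B Y U)) (eta X) p)
      - (dt (xi0 X) p *\<^sub>R (L Y + (1/2) *\<^sub>R (B U Y + B Y U)) + dU Y (dt (xi0 X)) p *\<^sub>R ?G p)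
    = d * dU Y (dx (dx (eta X))) p + (L (dU Y (eta X) p) + (B U (dU Y (eta X) p) + B Y (eta X p)))"
    using has_derivative_eq_on[OF open_D pD eq lhs rhs, of "(0,0,Y)"] by (simp add: p_def)
  moreover have "(1/2) *\<^sub>R (B U Y + B Y U) = B U Y"
    by (simp add: B_commute[of Y U] flip: scaleR_2)
  moreover have "dU Y (dU (?G p) (eta X)) p = 0"
    by (rule eta_UU[OF pD])
  moreover have "dU Y (dt (xi0 X)) p = 0"
    using dird_commute[OF open_D smooth_xi0 pD, of "(0,0,Y)" "(1,0,0)"]
      dird_zero_on[OF open_D pD xi0_U] by simp
  moreover have "dU Y (dt (eta X)) p = dt (dU Y (eta X)) p"
    by (rule dird_commute[OF open_D smooth_eta pD])
  ultimately show ?thesis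
    by (simp add: eta_xxU[OF pD] add.commute)
qed

text \<open>\<open>invariant_U\<close> differentiated once more, along \<open>Z\<close>:
  \<open>L\<close> and the \<open>t\<close>- and \<open>x\<close>-derivatives of
  \<open>\<eta>\<close> disappear, and only the product \<open>B\<close> with the factor
  \<open>\<xi>\<^sup>0\<^sub>t\<close> stays.\<close>

lemma derivation:
  assumes pD: "p \<in> D"
  shows "dU (B Z Y) (eta X) p - dt (xi0 X) p *\<^sub>R B Z Y = B Y (dU Z (eta X) p) + B Z (dU Y (eta X) p)"
proof -
  let ?U = "\<lambda>p::base. snd (snd p)"
  note hd = smooth_on_has_derivative[OF _ pD]
  have G: "((\<lambda>p. L Y + B (?U p) Y) has_derivative (\<lambda>k. 0 + B (?U k) Y)) (at p)"
    by (intro has_derivative_add has_derivative_const has_derivative_U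
        bounded_linear.has_derivative[OF bounded_bilinear.bounded_linear_left[OF B]])
  have lhs: "((\<lambda>p. dt (dU Y (eta X)) p + dU (L Y + B (?U p) Y) (eta X) p
      - dt (xi0 X) p *\<^sub>R (L Y + B (?U p) Y)) has_derivative
    (\<lambda>k. dird k (dt (dU Y (eta X))) p + (dird k (dU (L Y + B (?U p) Y) (eta X)) p
        + dU (0 + B (?U k) Y) (eta X) p)
      - (dt (xi0 X) p *\<^sub>R (0 + B (?U k) Y) + dird k (dt (xi0 X)) p *\<^sub>R (L Y + B (?U p) Y)))) (at p)"
    by (intro has_derivative_add has_derivative_diff has_derivative_scaleR hd smooth_coeffs1
        smooth_on_dird[OF open_D] smooth_coeffs
        has_derivative_dU_field[OF open_D smooth_eta pD] G)
  have rhs: "((\<lambda>p. - (dt (dt (xi0 X)) p / 4) *\<^sub>R Y + B Y (eta X p)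
      + (L (dU Y (eta X) p) + B (?U p) (dU Y (eta X) p))) has_derivative
    (\<lambda>k. - (dird k (dt (dt (xi0 X))) p / 4) *\<^sub>R Y + B Y (dird k (eta X) p)
      + (L (dird k (dU Y (eta X)) p) + (B (?U p) (dird k (dU Y (eta X)) p) + B (?U k) (dU Y (eta X) p))))) (at p)"
    by (intro has_derivative_add has_derivative_minus has_derivative_scaleR_left
        bounded_linear.has_derivative[OF bounded_linear_divide] bounded_linear.has_derivative[OF L]
        bounded_linear.has_derivative[OF bounded_bilinear.bounded_linear_right[OF B]]
        bounded_bilinear.FDERIV[OF B] has_derivative_U hd smooth_on_dird[OF open_D] smooth_coeffs)
  have eq: "dt (dU Y (eta X)) q + dU (L Y + B (?U q) Y) (eta X) q
      - dt (xi0 X) q *\<^sub>R (L Y + B (?U q) Y)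
    = - (dt (dt (xi0 X)) q / 4) *\<^sub>R Y + B Y (eta X q)
      + (L (dU Y (eta X) q) + B (?U q) (dU Y (eta X) q))" if "q \<in> D" for q
    using invariant_U[of "fst q" "fst (snd q)" "?U q"] that by simp
  have "dU Z (dt (dU Y (eta X))) p + (dU Z (dU (L Y + B (?U p) Y) (eta X)) p
        + dU (B Z Y) (eta X) p)
      - (dt (xi0 X) p *\<^sub>R B Z Y + dU Z (dt (xi0 X)) p *\<^sub>R (L Y + B (?U p) Y))
    = - (dU Z (dt (dt (xi0 X))) p / 4) *\<^sub>R Y + B Y (dU Z (eta X) p)
      + (L (dU Z (dU Y (eta X)) p) + (B (?U p) (dU Z (dU Y (eta X)) p) + B Z (dU Y (eta X) p)))"
    using has_derivative_eq_on[OF open_D pD eq lhs rhs, of "(0,0,Z)"] by simp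
  moreover have "dU Z (dt (dU Y (eta X))) p = 0"
    using dird_commute[OF open_D smooth_coeffs1(3) pD, of "(0,0,Z)" "(1,0,0)"]
      dird_zero_on[OF open_D pD eta_UU] by simp
  moreover have "dU Z (dt (xi0 X)) q = 0" if "q \<in> D" for q
    using dird_commute[OF open_D smooth_xi0 that, of "(0,0,Z)" "(1,0,0)"]
      dird_zero_on[OF open_D that xi0_U] by simp
  moreover from this have "dU Z (dt (dt (xi0 X))) p = 0"
    using dird_commute[OF open_D smooth_coeffs1(1) pD, of "(0,0,Z)" "(1,0,0)"]
      dird_zero_on[OF open_D pD, of "dU Z (dt (xi0 X))"] by simp
  ultimately show ?thesis
    using pD by (simp add: eta_UU linear_0[OF bounded_linear.linear[OF L]] bounded_bilinear.zero_right[OF B])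
qed

text \<open>Adding \<open>c\<close> times the identity to a linear map changes the left side of the
  derivation rule by \<open>c B(Z, Y)\<close> and the right side by \<open>2 c B(Z, Y)\<close>. With
  \<open>c = \<xi>\<^sup>0\<^sub>t\<close> this absorbs the extra term in
  \<open>derivation\<close>.\<close>

lemma eta_U:
  assumes "p \<in> D"
  shows "dU Y (eta X) p = - dt (xi0 X) p *\<^sub>R Y"
proof -
  let ?M = "\<lambda>Y. dU Y (eta X) p + dt (xi0 X) p *\<^sub>R Y"
  have "linear ?M"
    by (rule linearI) (simp_all only: dU_add[OF smooth_eta assms] dU_scaleR[OF smooth_eta assms],
      simp_all add: algebra_simps)
  moreover have "?M (B Z Y) = B Y (?M Z) + B Z (?M Y)" for Y Z
    using derivation[OF assms, of Z Y]
    by (simp add: bounded_bilinear.add_right[OF B] bounded_bilinear.scaleR_right[OF B] B_commute[of Y Z]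
        algebra_simps)
  ultimately have "?M Y = 0" by (rule no_derivation)
  then show ?thesis by (simp add: eq_neg_iff_add_eq_0)
qed

section \<open>Consequences of \<open>\<eta>\<^sub>U = - \<xi>\<^sup>0\<^sub>t\<close>\<close>

lemma xi0_tx:
  assumes "p \<in> D"
  shows "dx (dt (xi0 X)) p = 0"
proof -
  have "dx (dt (xi0 X)) p = dt (dx (xi0 X)) p"
    by (rule dird_commute[OF open_D smooth_xi0 assms])
  also have "\<dots> = 0" by (rule dird_zero_on[OF open_D assms xi0_x])
  finally show ?thesis .
qed

text \<open>By \<open>eta_U\<close> the derivative \<open>\<eta>\<^sub>U\<close> does not vary with
  \<open>x\<close>, so the left side of \<open>eta_xU\<close> vanishes.\<close>

lemma xi1_t:
  assumes "p \<in> D"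
  shows "dt (xi1 X) p = 0"
proof -
  let ?Y = "axis 1 1 :: real^3"
  have "dx (dU ?Y (eta X)) p = dx (\<lambda>p. dt (xi0 X) p *\<^sub>R - ?Y) p"
    by (rule dird_cong[OF open_D assms]) (simp add: eta_U)
  also have "\<dots> = dx (dt (xi0 X)) p *\<^sub>R - ?Y"
    by (rule dird_compose_linear[OF bounded_linear_scaleR_left smooth_coeffs1(1) assms])
  finally show ?thesis using xi0_tx[OF assms] eta_xU[OF assms, of ?Y] by simp
qed

lemma xi0_tt:
  assumes "p \<in> D"
  shows "dt (dt (xi0 X)) p = 0"
  using xi1_xt[OF assms] dird_zero_on[OF open_D assms xi1_t] by simp

lemma eta_tU:
  assumes "p \<in> D"
  shows "dt (dU Y (eta X)) p = 0"
proof -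
  have "dt (dU Y (eta X)) p = dt (\<lambda>p. dt (xi0 X) p *\<^sub>R - Y) p"
    by (rule dird_cong[OF open_D assms]) (simp add: eta_U)
  also have "\<dots> = dt (dt (xi0 X)) p *\<^sub>R - Y"
    by (rule dird_compose_linear[OF bounded_linear_scaleR_left smooth_coeffs1(1) assms])
  finally show ?thesis by (simp add: xi0_tt[OF assms])
qed

text \<open>By \<open>eta_U\<close> the vector \<open>\<eta> + \<xi>\<^sup>0\<^sub>t U\<close> has
  zero \<open>U\<close>-derivative: it is the constant term of the affine map \<open>\<eta>\<close>.
  Inserting \<open>eta_U\<close> into \<open>invariant_U\<close> leaves this condition on
  it.\<close>

lemma invariant_linear_part:
  assumes p: "(t, x, U) \<in> D"
  defines "p \<equiv> (t, x, U)"
  shows "B Y (eta X p + dt (xi0 X) p *\<^sub>R U) = - dt (xi0 X) p *\<^sub>R L Y"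
proof -
  have pD: "p \<in> D" using p by (simp add: p_def)
  define S where "S = dt (xi0 X) p *\<^sub>R (L Y + B U Y)"
  have "L (dU Y (eta X) p) + B U (dU Y (eta X) p) = - S"
    by (simp add: S_def eta_U[OF pD] linear_scale[OF bounded_linear.linear[OF L]]
        linear_neg[OF bounded_linear.linear[OF L]] bounded_bilinear.scaleR_right[OF B]
        bounded_bilinear.minus_right[OF B] scaleR_right_distrib)
  then have "0 + - S - S = - (0 / 4) *\<^sub>R Y + B Y (eta X p) + - S"
    using invariant_U[OF p, of Y]
    unfolding p_def[symmetric] eta_tU[OF pD] xi0_tt[OF pD] eta_U[OF pD, of "L Y + B U Y"]
      scaleR_minus_left S_def by simp
  then have "B Y (eta X p) = - S" by (simp add: vec_eq_iff eq_neg_iff_add_eq_0 add.commute)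
  then have "B Y (eta X p) = - (dt (xi0 X) p *\<^sub>R (L Y + B U Y))"
    by (simp only: S_def)
  then show ?thesis
    by (simp add: bounded_bilinear.add_right[OF B] bounded_bilinear.scaleR_right[OF B] B_commute[of Y U]
        algebra_simps)
qed

text \<open>\<open>invariant_rest\<close> with \<open>eta_U\<close> inserted;
  \<open>invariant_linear_part\<close> at \<open>Y = U\<close> removes the terms with
  \<open>B\<close>.\<close>

lemma invariant_constant_part:
  assumes p: "(t, x, U) \<in> D"
  defines "p \<equiv> (t, x, U)"
  shows "dt (eta X) p - d * dx (dx (eta X)) p = L (eta X p + dt (xi0 X) p *\<^sub>R U)"
proof -
  have pD: "p \<in> D" using p by (simp add: p_def)
  define q where "q = dt (xi0 X) p"
  \<comment> \<open>\<open>\<xi>\<^sup>0\<^sub>t\<close> times the reaction term. It is subtracted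
    twice in \<open>invariant_rest\<close>: through \<open>\<eta>\<^sub>U R\<close> and through
    \<open>\<xi>\<^sup>0\<^sub>t R\<close>.\<close>
  define \<rho> where "\<rho> = q *\<^sub>R (L U + (1/2) *\<^sub>R B U U)"
  have "B U (eta X p) + q *\<^sub>R B U U = - (q *\<^sub>R L U)"
    using invariant_linear_part[OF p, of U]
    by (simp add: p_def q_def bounded_bilinear.add_right[OF B] bounded_bilinear.scaleR_right[OF B])
  moreover have "\<rho> + \<rho> = q *\<^sub>R L U + q *\<^sub>R L U + q *\<^sub>R B U U"
    by (simp add: \<rho>_def vec_eq_iff algebra_simps)
  ultimately have 1: "B U (eta X p) + (\<rho> + \<rho>) = q *\<^sub>R L U"
    by (simp add: vec_eq_iff algebra_simps)
  have "dt (eta X) p - \<rho> - \<rho> = d * dx (dx (eta X)) p + (L (eta X p) + B U (eta X p))"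
    using invariant_rest[OF p] unfolding p_def[symmetric] eta_U[OF pD] \<rho>_def q_def by simp
  then have "dt (eta X) p - d * dx (dx (eta X)) p = L (eta X p) + (B U (eta X p) + (\<rho> + \<rho>))"
    by (simp add: algebra_simps)
  then show ?thesis
    unfolding 1 by (simp add: q_def linear_add[OF bounded_linear.linear[OF L]]
        linear_scale[OF bounded_linear.linear[OF L]])
qed

end

subsection \<open>Derivations of the reaction algebra\<close>

text \<open>In the next two lemmas \<open>(a1, a2, a3)\<close> and \<open>(c1, c2, c3)\<close> are the images of \<open>e\<^sub>1\<close> and \<open>e\<^sub>3\<close> under a derivation
  that kills \<open>e\<^sub>2\<close>, with \<open>m = \<kappa>2\<close> and \<open>n = \<kappa>1\<close>. The hypotheses are invariant under the exchange of
  \<open>u\<close> and \<open>w\<close>, which turns each conclusion about \<open>a\<close> into one about \<open>c\<close>.\<close>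

lemma derivation_entry_zero:
  fixes \<alpha>1 \<alpha>2 \<alpha>3 \<alpha>4 \<beta>1 \<beta>3 m n a1 a2 a3 c1 c2 c3 :: real
  defines "k \<equiv> n * \<alpha>3 + m * \<alpha>1"
  assumes nonneg: "\<alpha>1 \<ge> 0" "\<alpha>2 \<ge> 0" "\<alpha>3 \<ge> 0" "m > 0" "n > 0" "\<alpha>1 \<noteq> 0 \<or> \<alpha>3 \<noteq> 0"
    and "(\<alpha>2 + 2) * a2 = - m * \<alpha>2 * a1 - n * \<alpha>4 * a3" "\<alpha>2 * a3 = \<alpha>4 * a3"
      "(\<alpha>4 + 2) * c2 = - m * \<alpha>2 * c1 - n * \<alpha>4 * c3"
      "\<beta>1 * a1 = \<alpha>2 * a2 - \<alpha>1 * a3" "- \<beta>1 * a2 = - m * \<alpha>2 * a2 + k * a3" "\<beta>1 * a3 = \<alpha>3 * a3"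
      "- \<beta>3 * c2 = - n * \<alpha>4 * c2 + k * c1"
      "- \<alpha>3 * c1 = - 2 * \<beta>1 * c1 + \<alpha>2 * c2 - \<alpha>1 * c3"
      "- \<alpha>1 * a2 - \<alpha>3 * c2 = k * a1 - n * \<alpha>4 * a2 - m * \<alpha>2 * c2 + k * c3"
      "- \<alpha>1 * a3 = - \<alpha>3 * a1 + \<alpha>4 * a2 - 2 * \<beta>3 * a3"
  shows "a3 = 0"
proof (rule ccontr)
  assume a3: "a3 \<noteq> 0"
  \<comment> \<open>A nonzero \<open>a3\<close> can be cancelled, which ties the parameters
    together, first these and then \<open>\<beta>3 = \<alpha>1\<close>.\<close>
  then have eqs: "\<alpha>4 = \<alpha>2" "\<beta>1 = \<alpha>3" using assms by auto
  have "2 * \<alpha>1 * a3 = 2 * \<beta>3 * a3"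
    using assms(11,17) unfolding eqs by algebra
  then have \<beta>3: "\<beta>3 = \<alpha>1" using a3 by simp
  note hyps = assms(8-17)[unfolded eqs \<beta>3]
  have k: "k > 0"
    using nonneg by (auto simp: k_def less_le add_nonneg_eq_0_iff)
  show False
  proof (cases "\<alpha>3 = 0")
    case False
    \<comment> \<open>Eliminating \<open>a1\<close> and \<open>a3\<close> leaves \<open>a2\<close>
      with a nonzero factor.\<close>
    have "2 * \<alpha>3 * (k + \<alpha>2 * m * \<alpha>1 + m * n * \<alpha>2\<^sup>2) * a2 = 0"
      using hyps(1,4,5) unfolding k_def by algebra
    moreover have "k + \<alpha>2 * m * \<alpha>1 + m * n * \<alpha>2\<^sup>2 > 0"
      using k nonneg by (intro add_pos_nonneg) auto
    ultimately have "a2 = 0" using False by simp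
    then show False using hyps(5) k a3 by simp
  next
    case True
    then have \<alpha>1: "\<alpha>1 > 0" using nonneg by auto
    have pos: "\<alpha>1 + n * \<alpha>2\<^sup>2 > 0" using \<alpha>1 nonneg by (intro add_pos_nonneg) auto
    \<comment> \<open>Here the equations for \<open>c\<close> close among themselves; once
      \<open>c\<close> is gone, the mixed equation supplies the missing relation for
      \<open>a\<close>.\<close>
    have "2 * (\<alpha>1 + n * \<alpha>2\<^sup>2) * c2 = 0"
      using hyps(3,7,8) unfolding k_def True by algebra
    then have c2: "c2 = 0" using pos by simp
    then have "c3 = 0" "c1 = 0"
      using hyps(7,8) \<alpha>1 True nonneg k by simp_all
    have "\<alpha>2 * a2 = \<alpha>1 * a3" using hyps(4) True by simp
    then have "2 * (\<alpha>1 + n * \<alpha>2\<^sup>2) * a2 = 0"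
      using hyps(1,9) unfolding k_def True c2 \<open>c3 = 0\<close> by algebra
    then have "a2 = 0" using pos by simp
    then show False using hyps(5) k a3 by simp
  qed
qed

lemma derivation_row_zero:
  fixes \<alpha>1 \<alpha>2 \<alpha>3 \<alpha>4 \<beta>1 \<beta>3 m n a1 a2 c2 c3 :: real
  assumes nonneg: "\<alpha>1 \<ge> 0" "\<alpha>2 \<ge> 0" "\<alpha>4 \<ge> 0" "\<beta>1 \<ge> 0" "m > 0" "\<alpha>1 \<noteq> 0 \<or> \<alpha>3 \<noteq> 0"
    and "(\<alpha>2 + 2) * a2 = - m * \<alpha>2 * a1" "(\<alpha>4 + 2) * c2 = - n * \<alpha>4 * c3"
      "\<beta>1 * a1 = \<alpha>2 * a2" "\<alpha>2 * c2 = \<alpha>1 * c3" "\<alpha>3 * a1 = \<alpha>4 * a2"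
      "- \<alpha>1 * a2 - \<alpha>3 * c2 = (n * \<alpha>3 + m * \<alpha>1) * a1 - n * \<alpha>4 * a2 - m * \<alpha>2 * c2
        + (n * \<alpha>3 + m * \<alpha>1) * c3"
  shows "a1 = 0 \<and> a2 = 0"
proof -
  have "a1 = 0"
  proof (rule ccontr)
    assume a1: "a1 \<noteq> 0"
    \<comment> \<open>Eliminating \<open>a2\<close> leaves a factor that is a sum of nonnegative
      terms, so \<open>a1 \<noteq> 0\<close> forces \<open>\<alpha>2 = 0\<close>. Then
      \<open>\<alpha>3 = 0\<close>, and the last hypothesis shrinks to
      \<open>m * \<alpha>1 * a1 = 0\<close>.\<close>
    have "((\<alpha>2 + 2) * \<beta>1 + m * \<alpha>2\<^sup>2) * a1 = 0" using assms(7,9) by algebra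
    then have "(\<alpha>2 + 2) * \<beta>1 + m * \<alpha>2\<^sup>2 = 0" using a1 by simp
    moreover have "(\<alpha>2 + 2) * \<beta>1 \<ge> 0" "m * \<alpha>2\<^sup>2 \<ge> 0" using nonneg by simp_all
    ultimately have \<alpha>2: "\<alpha>2 = 0" using nonneg(5) by (simp add: add_nonneg_eq_0_iff)
    then have a2: "a2 = 0" using assms(7) by simp
    then have \<alpha>3: "\<alpha>3 = 0" using assms(11) a1 by simp
    then have \<alpha>1: "\<alpha>1 \<noteq> 0" using nonneg by simp
    then have c3: "c3 = 0" using assms(10) \<alpha>2 by simp
    then have "c2 = 0" using assms(8) nonneg by simp
    then show False using assms(12) a1 a2 c3 \<alpha>1 \<alpha>3 nonneg by simp
  qed
  then show ?thesis using assms(7) nonneg by simp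
qed

text \<open>The reaction term of the system is \<open>L U + B(U, U) / 2\<close> with \<open>L = lv_linear\<close> and
  \<open>B = lv_bilinear\<close>.\<close>

definition lv_linear :: "real \<Rightarrow> real \<Rightarrow> real^3 \<Rightarrow> real^3" where
  "lv_linear \<beta>1 \<beta>3 U = vector [\<beta>1 * U $ 1, U $ 2, \<beta>3 * U $ 3]"

definition lv_bilinear ::
  "real \<Rightarrow> real \<Rightarrow> real \<Rightarrow> real \<Rightarrow> real \<Rightarrow> real \<Rightarrow> real \<Rightarrow> real \<Rightarrow> real^3 \<Rightarrow> real^3 \<Rightarrow> real^3" where
  "lv_bilinear \<beta>1 \<beta>3 \<kappa>1 \<kappa>2 \<alpha>1 \<alpha>2 \<alpha>3 \<alpha>4 Y Z = vector [
     - 2 * \<beta>1 * Y $ 1 * Z $ 1 - \<alpha>1 * (Y $ 1 * Z $ 3 + Y $ 3 * Z $ 1) + \<alpha>2 * (Y $ 1 * Z $ 2 + Y $ 2 * Z $ 1),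
     - 2 * Y $ 2 * Z $ 2 + (\<kappa>1 * \<alpha>3 + \<kappa>2 * \<alpha>1) * (Y $ 1 * Z $ 3 + Y $ 3 * Z $ 1)
       - \<kappa>2 * \<alpha>2 * (Y $ 1 * Z $ 2 + Y $ 2 * Z $ 1) - \<kappa>1 * \<alpha>4 * (Y $ 2 * Z $ 3 + Y $ 3 * Z $ 2),
     - 2 * \<beta>3 * Y $ 3 * Z $ 3 - \<alpha>3 * (Y $ 1 * Z $ 3 + Y $ 3 * Z $ 1) + \<alpha>4 * (Y $ 2 * Z $ 3 + Y $ 3 * Z $ 2)]"

section \<open>Structural properties of \<open>lv_linear\<close> and
  \<open>lv_bilinear\<close>\<close>

lemma vec3_eq_iff: "(x :: 'a^3) = y \<longleftrightarrow> x $ 1 = y $ 1 \<and> x $ 2 = y $ 2 \<and> x $ 3 = y $ 3"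
  by (simp add: vec_eq_iff forall_3)

lemma bounded_linear_lv_linear: "bounded_linear (lv_linear \<beta>1 \<beta>3)"
  by (rule linear_conv_bounded_linear[THEN iffD1], rule linearI)
     (simp_all add: lv_linear_def vec3_eq_iff algebra_simps)

lemma bounded_bilinear_lv_bilinear: "bounded_bilinear (lv_bilinear \<beta>1 \<beta>3 \<kappa>1 \<kappa>2 \<alpha>1 \<alpha>2 \<alpha>3 \<alpha>4)"
  unfolding bilinear_conv_bounded_bilinear[symmetric] bilinear_def
  by (intro allI conjI linearI; simp add: lv_bilinear_def vec3_eq_iff; simp add: algebra_simps)

lemma lv_bilinear_commute:
  "lv_bilinear \<beta>1 \<beta>3 \<kappa>1 \<kappa>2 \<alpha>1 \<alpha>2 \<alpha>3 \<alpha>4 Y Z = lv_bilinear \<beta>1 \<beta>3 \<kappa>1 \<kappa>2 \<alpha>1 \<alpha>2 \<alpha>3 \<alpha>4 Z Y"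
  by (simp add: lv_bilinear_def vec3_eq_iff; simp add: algebra_simps)

lemma linear_vec3:
  fixes M :: "real^3 \<Rightarrow> real^3"
  assumes "linear M"
  shows "M V = V $ 1 *\<^sub>R M (vector [1, 0, 0]) + V $ 2 *\<^sub>R M (vector [0, 1, 0]) + V $ 3 *\<^sub>R M (vector [0, 0, 1])"
proof -
  have "V = V $ 1 *\<^sub>R vector [1, 0, 0] + V $ 2 *\<^sub>R vector [0, 1, 0] + V $ 3 *\<^sub>R vector [0, 0, 1]"
    by (simp add: vec3_eq_iff)
  then have "M V = M (V $ 1 *\<^sub>R vector [1, 0, 0] + V $ 2 *\<^sub>R vector [0, 1, 0] + V $ 3 *\<^sub>R vector [0, 0, 1])"
    by (rule arg_cong)
  also have "\<dots> = V $ 1 *\<^sub>R M (vector [1, 0, 0]) + V $ 2 *\<^sub>R M (vector [0, 1, 0]) + V $ 3 *\<^sub>R M (vector [0, 0, 1])"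
    by (simp only: linear_add[OF assms] linear_scale[OF assms])
  finally show ?thesis .
qed

text \<open>The rule is evaluated on the six pairs of basis vectors. The logistic term of
  \<open>v\<close> makes \<open>B e\<^sub>2 e\<^sub>2 = - 2 e\<^sub>2\<close>, which kills
  \<open>M e\<^sub>2\<close>; the other five pairs feed \<open>derivation_entry_zero\<close> and
  \<open>derivation_row_zero\<close>.\<close>

lemma lv_no_derivation:
  fixes \<beta>1 \<beta>3 \<kappa>1 \<kappa>2 \<alpha>1 \<alpha>2 \<alpha>3 \<alpha>4 :: real
  defines "B \<equiv> lv_bilinear \<beta>1 \<beta>3 \<kappa>1 \<kappa>2 \<alpha>1 \<alpha>2 \<alpha>3 \<alpha>4"
  assumes nonneg: "\<beta>1 \<ge> 0" "\<beta>3 \<ge> 0" "\<kappa>1 > 0" "\<kappa>2 > 0" "\<alpha>1 \<ge> 0" "\<alpha>2 \<ge> 0" "\<alpha>3 \<ge> 0" "\<alpha>4 \<ge> 0"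
      "\<alpha>1 \<noteq> 0 \<or> \<alpha>3 \<noteq> 0"
    and M: "linear M" and der: "\<And>Y Z. M (B Z Y) = B Y (M Z) + B Z (M Y)"
  shows "M V = 0"
proof -
  let ?e1 = "vector [1, 0, 0] :: real^3" and ?e2 = "vector [0, 1, 0] :: real^3"
    and ?e3 = "vector [0, 0, 1] :: real^3"
  define a where "a = M ?e1"
  define p where "p = M ?e2"
  define c where "c = M ?e3"
  have eqs: "(B Z Y) $ 1 * a $ i + (B Z Y) $ 2 * p $ i + (B Z Y) $ 3 * c $ i
      = (B Y (M Z)) $ i + (B Z (M Y)) $ i" for Y Z i
  proof -
    have "(B Z Y) $ 1 *\<^sub>R a + (B Z Y) $ 2 *\<^sub>R p + (B Z Y) $ 3 *\<^sub>R c = B Y (M Z) + B Z (M Y)"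
      unfolding a_def p_def c_def by (rule trans[OF linear_vec3[OF M, of "B Z Y", symmetric] der])
    from this[THEN arg_cong[where f="\<lambda>v. v $ i"]] show ?thesis
      by (simp only: vector_add_component vector_scaleR_component real_scaleR_def)
  qed
  note eqs = eqs[unfolded B_def lv_bilinear_def]
  note e22 = eqs[of ?e2 ?e2, folded p_def, simplified]
  have "(\<alpha>2 + 1) * p $ 1 = 0" "(\<alpha>4 + 1) * p $ 3 = 0"
    using e22[of 1, simplified] e22[of 3, simplified] by algebra+
  then have p13: "p $ 1 = 0" "p $ 3 = 0" using nonneg by simp_all
  then have p: "p $ 2 = 0" using e22[of 2, simplified] by simp
  note p = p13 p
  note e12 = eqs[of ?e2 ?e1, folded a_def p_def, simplified]
  note e23 = eqs[of ?e2 ?e3, folded c_def p_def, simplified]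
  note e11 = eqs[of ?e1 ?e1, folded a_def, simplified]
  note e33 = eqs[of ?e3 ?e3, folded c_def, simplified]
  note e13 = eqs[of ?e3 ?e1, folded a_def c_def, simplified]
  have h: "(\<alpha>2 + 2) * a $ 2 = - \<kappa>2 * \<alpha>2 * a $ 1 - \<kappa>1 * \<alpha>4 * a $ 3"
    "\<alpha>2 * a $ 3 = \<alpha>4 * a $ 3"
    "(\<alpha>4 + 2) * c $ 2 = - \<kappa>2 * \<alpha>2 * c $ 1 - \<kappa>1 * \<alpha>4 * c $ 3"
    "\<alpha>4 * c $ 1 = \<alpha>2 * c $ 1"
    using e12[of 2, simplified p, simplified] e12[of 3, simplified p, simplified]
      e23[of 2, simplified p, simplified] e23[of 1, simplified p, simplified] by algebra+
  have h': "\<beta>1 * a $ 1 = \<alpha>2 * a $ 2 - \<alpha>1 * a $ 3"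
    "- \<beta>1 * a $ 2 = - \<kappa>2 * \<alpha>2 * a $ 2 + (\<kappa>1 * \<alpha>3 + \<kappa>2 * \<alpha>1) * a $ 3"
    "\<beta>1 * a $ 3 = \<alpha>3 * a $ 3"
    using e11[of 1, simplified] e11[of 2, simplified] e11[of 3, simplified] by algebra+
  have h33: "\<beta>3 * c $ 3 = \<alpha>4 * c $ 2 - \<alpha>3 * c $ 1"
    "- \<beta>3 * c $ 2 = - \<kappa>1 * \<alpha>4 * c $ 2 + (\<kappa>1 * \<alpha>3 + \<kappa>2 * \<alpha>1) * c $ 1"
    "\<beta>3 * c $ 1 = \<alpha>1 * c $ 1"
    using e33[of 3, simplified] e33[of 2, simplified] e33[of 1, simplified] by algebra+
  have h'': "- \<alpha>3 * c $ 1 = - 2 * \<beta>1 * c $ 1 + \<alpha>2 * c $ 2 - \<alpha>1 * c $ 3"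
    "- \<alpha>1 * a $ 2 - \<alpha>3 * c $ 2 = (\<kappa>1 * \<alpha>3 + \<kappa>2 * \<alpha>1) * a $ 1 - \<kappa>1 * \<alpha>4 * a $ 2
      - \<kappa>2 * \<alpha>2 * c $ 2 + (\<kappa>1 * \<alpha>3 + \<kappa>2 * \<alpha>1) * c $ 3"
    "- \<alpha>1 * a $ 3 = - \<alpha>3 * a $ 1 + \<alpha>4 * a $ 2 - 2 * \<beta>3 * a $ 3"
    using e13[of 1, simplified p, simplified] e13[of 2, simplified p, simplified]
      e13[of 3, simplified p, simplified] by algebra+
  \<comment> \<open>The same equations in the shape that results from exchanging \<open>u\<close>
    and \<open>w\<close>: \<alpha>1 with \<alpha>3, \<alpha>2 with \<alpha>4, \<beta>1 with
    \<beta>3, \<kappa>1 with \<kappa>2, and \<open>a\<close> with \<open>c\<close>, the indices 1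
    and 3 being swapped.\<close>
  have h2': "\<alpha>4 * c $ 1 = \<alpha>2 * c $ 1"
      "(\<alpha>4 + 2) * c $ 2 = - \<kappa>1 * \<alpha>4 * c $ 3 - \<kappa>2 * \<alpha>2 * c $ 1"
      "(\<alpha>2 + 2) * a $ 2 = - \<kappa>1 * \<alpha>4 * a $ 3 - \<kappa>2 * \<alpha>2 * a $ 1"
      "- \<beta>3 * c $ 2 = - \<kappa>1 * \<alpha>4 * c $ 2 + (\<kappa>2 * \<alpha>1 + \<kappa>1 * \<alpha>3) * c $ 1"
      "- \<beta>1 * a $ 2 = - \<kappa>2 * \<alpha>2 * a $ 2 + (\<kappa>2 * \<alpha>1 + \<kappa>1 * \<alpha>3) * a $ 3"
      "- \<alpha>1 * a $ 3 = - 2 * \<beta>3 * a $ 3 + \<alpha>4 * a $ 2 - \<alpha>3 * a $ 1"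
      "- \<alpha>3 * c $ 2 - \<alpha>1 * a $ 2 = (\<kappa>2 * \<alpha>1 + \<kappa>1 * \<alpha>3) * c $ 3 - \<kappa>2 * \<alpha>2 * c $ 2
        - \<kappa>1 * \<alpha>4 * a $ 2 + (\<kappa>2 * \<alpha>1 + \<kappa>1 * \<alpha>3) * a $ 1"
      "- \<alpha>3 * c $ 1 = - \<alpha>1 * c $ 3 + \<alpha>2 * c $ 2 - 2 * \<beta>1 * c $ 1"
    using h h' h33 h'' by algebra+
  have a3: "a $ 3 = 0"
    by (rule derivation_entry_zero[of \<alpha>1 \<alpha>2 \<alpha>3 \<kappa>2 \<kappa>1, OF nonneg(5-7,4,3,9) h(1-3) h'(1-3) h33(2) h''])
  have c1: "c $ 1 = 0"
    by (rule derivation_entry_zero[of \<alpha>3 \<alpha>4 \<alpha>1 \<kappa>1 \<kappa>2, OF nonneg(7,8,5,3,4) _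
          h2'(2,1,3) h33(1) h2'(4) h33(3) h2'(5-8)]) (use nonneg(9) in blast)
  have a12: "a $ 1 = 0 \<and> a $ 2 = 0"
    by (rule derivation_row_zero[of \<alpha>1 \<alpha>2 \<alpha>4 \<beta>1 \<kappa>2 \<alpha>3 "a $ 2" "a $ 1" "c $ 2" \<kappa>1 "c $ 3"])
       (use nonneg(1,4-6,8,9) h(1,3) h'(1) h''(2) h''(1,3)[unfolded a3 c1] in \<open>simp_all add: a3 c1\<close>)
  have c23: "c $ 3 = 0 \<and> c $ 2 = 0"
    by (rule derivation_row_zero[of \<alpha>3 \<alpha>4 \<alpha>2 \<beta>3 \<kappa>1 \<alpha>1 "c $ 2" "c $ 3" "a $ 2" \<kappa>2 "a $ 1"])
       (use nonneg(2,3,6-9) h2'(2,3,7) h33(1) h2'(6,8)[unfolded a3 c1] in \<open>auto simp add: a3 c1 a12\<close>)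
  have "a = 0" "p = 0" "c = 0" using a3 c1 a12 c23 p by (simp_all add: vec3_eq_iff)
  then show ?thesis
    using linear_vec3[OF M, of V] unfolding a_def[symmetric] p_def[symmetric] c_def[symmetric] by simp
qed

text \<open>At \<open>Y = e\<^sub>2\<close> the outer components kill
  \<open>\<alpha>2 * b $ 1\<close> and \<open>\<alpha>4 * b $ 3\<close>, so the middle one reduces
  to the logistic term of \<open>v\<close>. For \<open>q = 0\<close> the middle components at
  \<open>e\<^sub>1\<close> and \<open>e\<^sub>3\<close> give the rest, the coefficient of
  \<open>u w\<close> being positive.\<close>

lemma lv_linear_part_solution:
  fixes \<beta>1 \<beta>3 \<kappa>1 \<kappa>2 \<alpha>1 \<alpha>2 \<alpha>3 \<alpha>4 :: real
  assumes nonneg: "\<kappa>1 > 0" "\<kappa>2 > 0" "\<alpha>1 \<ge> 0" "\<alpha>3 \<ge> 0" "\<alpha>1 \<noteq> 0 \<or> \<alpha>3 \<noteq> 0"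
    and eq: "\<And>Y. lv_bilinear \<beta>1 \<beta>3 \<kappa>1 \<kappa>2 \<alpha>1 \<alpha>2 \<alpha>3 \<alpha>4 Y b = - q *\<^sub>R lv_linear \<beta>1 \<beta>3 Y"
  shows "b $ 2 = q / 2" and "q = 0 \<Longrightarrow> b = 0"
proof -
  note eq' = eq[unfolded lv_bilinear_def lv_linear_def vec3_eq_iff, simplified]
  have \<alpha>2: "\<alpha>2 * b $ 1 = 0" and \<alpha>4: "\<alpha>4 * b $ 3 = 0"
    using eq'[of "vector [0, 1, 0]"] by simp_all
  have "- (2 * b $ 2) - \<kappa>2 * (\<alpha>2 * b $ 1) - \<kappa>1 * (\<alpha>4 * b $ 3) = - q"
    using eq'[of "vector [0, 1, 0]"] by (simp add: mult.assoc)
  then show b2: "b $ 2 = q / 2" unfolding \<alpha>2 \<alpha>4 by simp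
  assume "q = 0"
  then have "b $ 2 = 0" using b2 by simp
  then have "(\<kappa>1 * \<alpha>3 + \<kappa>2 * \<alpha>1) * b $ 3 = 0" "(\<kappa>1 * \<alpha>3 + \<kappa>2 * \<alpha>1) * b $ 1 = 0"
    using eq'[of "vector [1, 0, 0]"] eq'[of "vector [0, 0, 1]"] by simp_all
  moreover have "\<kappa>1 * \<alpha>3 + \<kappa>2 * \<alpha>1 > 0"
    using nonneg by (auto simp: less_le add_nonneg_eq_0_iff)
  ultimately show "b = 0" using \<open>b $ 2 = 0\<close> by (simp add: vec3_eq_iff)
qed

subsection \<open>Lie symmetries of the system\<close>

lemma has_derivative_jet_nth:
  "bounded_linear L \<Longrightarrow> ((\<lambda>j. L j $ i) has_derivative (\<lambda>k. L k $ i)) (at j)"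
  by (intro bounded_linear.has_derivative[OF bounded_linear_vec_nth] bounded_linear_imp_has_derivative)

text \<open>The projections to \<open>U\<close>, \<open>U\<^sub>t\<close> and
  \<open>U\<^sub>x\<^sub>x\<close>, the jet coordinates that occur in the equations.\<close>

lemmas bounded_linear_jet =
  bounded_linear_compose[OF bounded_linear_snd bounded_linear_compose[OF bounded_linear_snd
    bounded_linear_compose[OF bounded_linear_fst bounded_linear_fst]]]
  bounded_linear_compose[OF bounded_linear_fst bounded_linear_compose[OF bounded_linear_snd
    bounded_linear_fst]]
  bounded_linear_compose[OF bounded_linear_snd bounded_linear_compose[OF bounded_linear_snd
    bounded_linear_snd]]

lemmas has_derivative_jet = bounded_linear_jet[THEN has_derivative_jet_nth]

text \<open>Phrased with the full parameter set, so that the three linearised equations become the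
  components of one vector equation.\<close>

lemma frechet_derivative_eq_u:
  "frechet_derivative (eq_u d1 \<beta>1 \<alpha>1 \<alpha>2) (at (((t, x, U), Ut, Ux), Utt, Utx, Uxx))
      (((t', x', U'), Ut', Ux'), Utt', Utx', Uxx')
    = Ut' $ 1 - (d1 * Uxx' $ 1 + (lv_linear \<beta>1 \<beta>3 U' + lv_bilinear \<beta>1 \<beta>3 \<kappa>1 \<kappa>2 \<alpha>1 \<alpha>2 \<alpha>3 \<alpha>4 U U') $ 1)"
proof -
  have eq: "eq_u d1 \<beta>1 \<alpha>1 \<alpha>2 = (\<lambda>j. fst (snd (fst j)) $ 1 - (d1 * snd (snd (snd j)) $ 1
      + \<beta>1 * snd (snd (fst (fst j))) $ 1 * (1 - snd (snd (fst (fst j))) $ 1)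
      - \<alpha>1 * snd (snd (fst (fst j))) $ 1 * snd (snd (fst (fst j))) $ 3
      + \<alpha>2 * snd (snd (fst (fst j))) $ 1 * snd (snd (fst (fst j))) $ 2))"
    by (simp add: eq_u_def fun_eq_iff Let_def)
  show ?thesis
    unfolding eq
    by (rule trans[OF dird_eq[unfolded dird_def]], (rule derivative_eq_intros has_derivative_jet refl)+)
       (simp add: lv_linear_def lv_bilinear_def algebra_simps)
qed

lemma frechet_derivative_eq_v:
  "frechet_derivative (eq_v \<kappa>1 \<kappa>2 \<alpha>1 \<alpha>2 \<alpha>3 \<alpha>4) (at (((t, x, U), Ut, Ux), Utt, Utx, Uxx))
      (((t', x', U'), Ut', Ux'), Utt', Utx', Uxx')
    = Ut' $ 2 - (Uxx' $ 2 + (lv_linear \<beta>1 \<beta>3 U' + lv_bilinear \<beta>1 \<beta>3 \<kappa>1 \<kappa>2 \<alpha>1 \<alpha>2 \<alpha>3 \<alpha>4 U U') $ 2)"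
proof -
  have eq: "eq_v \<kappa>1 \<kappa>2 \<alpha>1 \<alpha>2 \<alpha>3 \<alpha>4 = (\<lambda>j. fst (snd (fst j)) $ 2 - (snd (snd (snd j)) $ 2
      + snd (snd (fst (fst j))) $ 2 * (1 - snd (snd (fst (fst j))) $ 2)
      + (\<kappa>1 * \<alpha>3 + \<kappa>2 * \<alpha>1) * snd (snd (fst (fst j))) $ 1 * snd (snd (fst (fst j))) $ 3
      - (\<kappa>2 * \<alpha>2 * snd (snd (fst (fst j))) $ 1 + \<kappa>1 * \<alpha>4 * snd (snd (fst (fst j))) $ 3)
        * snd (snd (fst (fst j))) $ 2))"
    by (simp add: eq_v_def fun_eq_iff Let_def)
  show ?thesis
    unfolding eq
    by (rule trans[OF dird_eq[unfolded dird_def]], (rule derivative_eq_intros has_derivative_jet refl)+)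
       (simp add: lv_linear_def lv_bilinear_def algebra_simps)
qed

lemma frechet_derivative_eq_w:
  "frechet_derivative (eq_w d3 \<beta>3 \<alpha>3 \<alpha>4) (at (((t, x, U), Ut, Ux), Utt, Utx, Uxx))
      (((t', x', U'), Ut', Ux'), Utt', Utx', Uxx')
    = Ut' $ 3 - (d3 * Uxx' $ 3 + (lv_linear \<beta>1 \<beta>3 U' + lv_bilinear \<beta>1 \<beta>3 \<kappa>1 \<kappa>2 \<alpha>1 \<alpha>2 \<alpha>3 \<alpha>4 U U') $ 3)"
proof -
  have eq: "eq_w d3 \<beta>3 \<alpha>3 \<alpha>4 = (\<lambda>j. fst (snd (fst j)) $ 3 - (d3 * snd (snd (snd j)) $ 3
      + \<beta>3 * snd (snd (fst (fst j))) $ 3 * (1 - snd (snd (fst (fst j))) $ 3)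
      - \<alpha>3 * snd (snd (fst (fst j))) $ 1 * snd (snd (fst (fst j))) $ 3
      + \<alpha>4 * snd (snd (fst (fst j))) $ 2 * snd (snd (fst (fst j))) $ 3))"
    by (simp add: eq_w_def fun_eq_iff Let_def)
  show ?thesis
    unfolding eq
    by (rule trans[OF dird_eq[unfolded dird_def]], (rule derivative_eq_intros has_derivative_jet refl)+)
       (simp add: lv_linear_def lv_bilinear_def algebra_simps)
qed

section \<open>The two translations\<close>

lemma smooth_on_const: "smooth_on S (\<lambda>_. c)"
proof -
  have "Ck_on k S (\<lambda>_. c)" for k by (cases k) (simp_all add: Ck_on_zero)
  then show ?thesis by (simp add: smooth_on_def)
qed

lemma prolong2_translation: "prolong2 (\<lambda>_. (a, b, 0)) j = (((a, b, 0), 0, 0), 0, 0, 0)"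
proof -
  \<comment> \<open>Equalities of functions, since the second-order coefficients differentiate
    them.\<close>
  have zt: "zeta_t (\<lambda>_. (a, b, 0)) = (\<lambda>_. 0)" and zx: "zeta_x (\<lambda>_. (a, b, 0)) = (\<lambda>_. 0)"
    by (simp_all add: zeta_t_def zeta_x_def Dt0_def Dx0_def xi0_def[abs_def] xi1_def[abs_def]
        eta_def[abs_def] fun_eq_iff)
  show ?thesis
    unfolding prolong2_def zeta_tt_def zeta_tx_def zeta_xx_def zt zx
    by (simp add: case_prod_unfold Dt0_def Dx0_def Dt1_def Dx1_def xi0_def[abs_def] xi1_def[abs_def])
qed

lemma lie_symmetry_translation:
  "lie_symmetry D (rd_system d1 d3 \<beta>1 \<beta>3 \<kappa>1 \<kappa>2 \<alpha>1 \<alpha>2 \<alpha>3 \<alpha>4) (\<lambda>_. (a, b, 0))"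
proof -
  have "lv_linear \<beta>1 \<beta>3 0 + lv_bilinear \<beta>1 \<beta>3 \<kappa>1 \<kappa>2 \<alpha>1 \<alpha>2 \<alpha>3 \<alpha>4 U 0 = 0" for U
    by (simp add: lv_linear_def lv_bilinear_def vec3_eq_iff)
  then show ?thesis
    unfolding lie_symmetry_def rd_system_def
    by (auto simp: prolong2_translation smooth_on_const
        frechet_derivative_eq_u[where ?\<beta>3.0=\<beta>3 and ?\<kappa>1.0=\<kappa>1 and ?\<kappa>2.0=\<kappa>2 and ?\<alpha>3.0=\<alpha>3 and ?\<alpha>4.0=\<alpha>4]
        frechet_derivative_eq_v[where ?\<beta>1.0=\<beta>1 and ?\<beta>3.0=\<beta>3]
        frechet_derivative_eq_w[where ?\<beta>1.0=\<beta>1 and ?\<kappa>1.0=\<kappa>1 and ?\<kappa>2.0=\<kappa>2 and ?\<alpha>1.0=\<alpha>1 and ?\<alpha>2.0=\<alpha>2])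
qed

text \<open>Supplies the premise \<open>invariant\<close> of \<open>rd_symmetry\<close>.\<close>

lemma lie_symmetry_vector_form:
  assumes sym: "lie_symmetry D (rd_system d1 d3 \<beta>1 \<beta>3 \<kappa>1 \<kappa>2 \<alpha>1 \<alpha>2 \<alpha>3 \<alpha>4) X" and p: "(t, x, U) \<in> D"
  defines "L \<equiv> lv_linear \<beta>1 \<beta>3" and "B \<equiv> lv_bilinear \<beta>1 \<beta>3 \<kappa>1 \<kappa>2 \<alpha>1 \<alpha>2 \<alpha>3 \<alpha>4"
    and "d \<equiv> vector [d1, 1, d3]"
  shows "zeta_t X ((t, x, U), d * Uxx + (L U + (1/2) *\<^sub>R B U U), Ux)
    = d * zeta_xx X (((t, x, U), d * Uxx + (L U + (1/2) *\<^sub>R B U U), Ux), Utt, Utx, Uxx)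
      + (L (eta X (t, x, U)) + B U (eta X (t, x, U)))"
proof -
  let ?E = "rd_system d1 d3 \<beta>1 \<beta>3 \<kappa>1 \<kappa>2 \<alpha>1 \<alpha>2 \<alpha>3 \<alpha>4"
  \<comment> \<open>Solving the system for \<open>U\<^sub>t\<close> puts the jet on the solution set
    for every choice of the other coordinates.\<close>
  define Ut where "Ut = d * Uxx + (L U + (1/2) *\<^sub>R B U U)"
  let ?j = "(((t, x, U), Ut, Ux), Utt, Utx, Uxx)"
  have sol: "\<forall>G\<in>?E. G ?j = 0"
    by (simp add: rd_system_def eq_u_def eq_v_def eq_w_def Let_def Ut_def d_def L_def B_def
        lv_linear_def lv_bilinear_def algebra_simps)
  have X: "prolong2 X ?j = (((xi0 X (t, x, U), xi1 X (t, x, U), eta X (t, x, U)),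
      zeta_t X ((t, x, U), Ut, Ux), zeta_x X ((t, x, U), Ut, Ux)),
      zeta_tt X ?j, zeta_tx X ?j, zeta_xx X ?j)"
    by (simp add: prolong2_def xi0_def xi1_def eta_def)
  have "frechet_derivative F (at ?j) (prolong2 X ?j) = 0" if "F \<in> ?E" for F
    using sym that sol p unfolding lie_symmetry_def by fastforce
  then have "frechet_derivative (eq_u d1 \<beta>1 \<alpha>1 \<alpha>2) (at ?j) (prolong2 X ?j) = 0"
    "frechet_derivative (eq_v \<kappa>1 \<kappa>2 \<alpha>1 \<alpha>2 \<alpha>3 \<alpha>4) (at ?j) (prolong2 X ?j) = 0"
    "frechet_derivative (eq_w d3 \<beta>3 \<alpha>3 \<alpha>4) (at ?j) (prolong2 X ?j) = 0"
    by (simp_all add: rd_system_def)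
  then show ?thesis
    unfolding X Ut_def[symmetric]
      frechet_derivative_eq_u[where ?\<beta>3.0=\<beta>3 and ?\<kappa>1.0=\<kappa>1 and ?\<kappa>2.0=\<kappa>2 and ?\<alpha>3.0=\<alpha>3 and ?\<alpha>4.0=\<alpha>4]
      frechet_derivative_eq_v[where ?\<beta>1.0=\<beta>1 and ?\<beta>3.0=\<beta>3]
      frechet_derivative_eq_w[where ?\<beta>1.0=\<beta>1 and ?\<kappa>1.0=\<kappa>1 and ?\<kappa>2.0=\<kappa>2 and ?\<alpha>1.0=\<alpha>1 and ?\<alpha>2.0=\<alpha>2]
      L_def[symmetric] B_def[symmetric]
    by (simp add: vec3_eq_iff d_def)
qed

lemma gradient_zero_constant:
  assumes "open S" "connected S" and f: "smooth_on S f" "\<And>p v. p \<in> S \<Longrightarrow> dird v f p = 0"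
    and "p \<in> S" "q \<in> S"
  shows "f p = f q"
  using has_derivative_zero_unique_connected[OF assms(1,2) _ assms(5,6), of f]
    smooth_on_has_derivative[OF f(1)] f(2) by simp

theorem theorem1:
  fixes d1 d3 \<beta>1 \<beta>3 \<kappa>1 \<kappa>2 \<alpha>1 \<alpha>2 \<alpha>3 \<alpha>4 :: real
    and D :: "base set"
  assumes "d1 \<ge> 0" and "d3 \<ge> 0" and "\<beta>1 \<ge> 0" and "\<beta>3 \<ge> 0" and "\<kappa>1 \<ge> 0" and "\<kappa>2 \<ge> 0"
    and "\<alpha>1 \<ge> 0" and "\<alpha>2 \<ge> 0" and "\<alpha>3 \<ge> 0" and "\<alpha>4 \<ge> 0"
    and "d1 * d3 * \<kappa>1 * \<kappa>2 \<noteq> 0"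
    and "\<alpha>1\<^sup>2 + \<alpha>3\<^sup>2 \<noteq> 0"
    and "open D" and "connected D"
  shows "lie_symmetry D (rd_system d1 d3 \<beta>1 \<beta>3 \<kappa>1 \<kappa>2 \<alpha>1 \<alpha>2 \<alpha>3 \<alpha>4) P_t \<and>
    lie_symmetry D (rd_system d1 d3 \<beta>1 \<beta>3 \<kappa>1 \<kappa>2 \<alpha>1 \<alpha>2 \<alpha>3 \<alpha>4) P_x \<and>
    (\<forall>X. lie_symmetry D (rd_system d1 d3 \<beta>1 \<beta>3 \<kappa>1 \<kappa>2 \<alpha>1 \<alpha>2 \<alpha>3 \<alpha>4) X \<longrightarrow>
      (\<exists>a b :: real. \<forall>p\<in>D. X p = a *\<^sub>R P_t p + b *\<^sub>R P_x p))"
proof (intro conjI allI impI)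
  let ?E = "rd_system d1 d3 \<beta>1 \<beta>3 \<kappa>1 \<kappa>2 \<alpha>1 \<alpha>2 \<alpha>3 \<alpha>4"
  show "lie_symmetry D ?E P_t" "lie_symmetry D ?E P_x"
    unfolding P_t_def P_x_def by (rule lie_symmetry_translation)+
  fix X assume sym: "lie_symmetry D ?E X"
  have pos: "d1 > 0" "d3 > 0" "\<kappa>1 > 0" "\<kappa>2 > 0" "\<alpha>1 \<noteq> 0 \<or> \<alpha>3 \<noteq> 0"
    using assms(1,2,5,6,11,12) by (auto simp: less_le)
  interpret rd_quadratic D X "vector [d1, 1, d3]" "lv_linear \<beta>1 \<beta>3"
    "lv_bilinear \<beta>1 \<beta>3 \<kappa>1 \<kappa>2 \<alpha>1 \<alpha>2 \<alpha>3 \<alpha>4"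
  proof (intro rd_quadratic.intro rd_symmetry.intro rd_quadratic_axioms.intro)
    show "open D" by fact
    show "smooth_on D X" using sym by (simp add: lie_symmetry_def)
    show "(vector [d1, 1, d3] :: real^3) $ a > 0" for a
      using exhaust_3[of a] pos by auto
    show "lv_bilinear \<beta>1 \<beta>3 \<kappa>1 \<kappa>2 \<alpha>1 \<alpha>2 \<alpha>3 \<alpha>4 Y Z = lv_bilinear \<beta>1 \<beta>3 \<kappa>1 \<kappa>2 \<alpha>1 \<alpha>2 \<alpha>3 \<alpha>4 Z Y" for Y Z
      by (rule lv_bilinear_commute)
    show "M Y = 0" if "linear M" "\<And>Y Z. M (lv_bilinear \<beta>1 \<beta>3 \<kappa>1 \<kappa>2 \<alpha>1 \<alpha>2 \<alpha>3 \<alpha>4 Z Y) =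
        lv_bilinear \<beta>1 \<beta>3 \<kappa>1 \<kappa>2 \<alpha>1 \<alpha>2 \<alpha>3 \<alpha>4 Y (M Z) + lv_bilinear \<beta>1 \<beta>3 \<kappa>1 \<kappa>2 \<alpha>1 \<alpha>2 \<alpha>3 \<alpha>4 Z (M Y)"
      for M Y
      by (rule lv_no_derivation[OF assms(3,4) pos(3,4) assms(7-10) pos(5) that])
  qed (rule lie_symmetry_vector_form[OF sym] bounded_linear_lv_linear bounded_bilinear_lv_bilinear; assumption)+
  have b: "(eta X p + dt (xi0 X) p *\<^sub>R snd (snd p)) $ 2 = dt (xi0 X) p / 2"
    "dt (xi0 X) p = 0 \<Longrightarrow> eta X p + dt (xi0 X) p *\<^sub>R snd (snd p) = 0" if "p \<in> D" for p
    using lv_linear_part_solution[OF pos(3,4) assms(7,9) pos(5),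
        of \<beta>1 \<beta>3 \<alpha>2 \<alpha>4 "eta X p + dt (xi0 X) p *\<^sub>R snd (snd p)" "dt (xi0 X) p"]
      invariant_linear_part[of "fst p" "fst (snd p)" "snd (snd p)"] that by simp_all
  \<comment> \<open>By \<open>b\<close>, the second component of \<open>\<eta>\<close> is
    \<open>\<xi>\<^sup>0\<^sub>t / 2 - \<xi>\<^sup>0\<^sub>t v\<close>, and
    \<open>\<xi>\<^sup>0\<^sub>t\<close> has zero \<open>t\<close>- and
    \<open>x\<close>-derivative.\<close>
  have eta2: "dird k (eta X) p $ 2 = 0" if "p \<in> D" and k: "k = (1, 0, 0) \<or> k = (0, 1, 0)" for p k
  proof -
    have 0: "dird k (dt (xi0 X)) p = 0" using that(1) k xi0_tt xi0_tx by blast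
    have "((\<lambda>p. dt (xi0 X) p / 2 - dt (xi0 X) p * snd (snd p) $ 2) has_derivative
      (\<lambda>k. dird k (dt (xi0 X)) p / 2
        - (dt (xi0 X) p * snd (snd k) $ 2 + dird k (dt (xi0 X)) p * snd (snd p) $ 2))) (at p)"
      by (intro has_derivative_diff has_derivative_mult bounded_linear.has_derivative[OF bounded_linear_divide]
          bounded_linear.has_derivative[OF bounded_linear_vec_nth] has_derivative_U
          smooth_on_has_derivative[OF smooth_coeffs1(1) that(1)])
    from dird_eq[OF this, of k]
    have "dird k (\<lambda>p. dt (xi0 X) p / 2 - dt (xi0 X) p * snd (snd p) $ 2) p = 0"
      using k unfolding 0 by auto
    moreover have "dird k (\<lambda>p. eta X p $ 2) p
        = dird k (\<lambda>p. dt (xi0 X) p / 2 - dt (xi0 X) p * snd (snd p) $ 2) p"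
      by (rule dird_cong[OF open_D that(1)]) (use b(1) in \<open>simp add: algebra_simps\<close>)
    ultimately show ?thesis using dird_vec_nth[OF smooth_eta that(1)] by simp
  qed
  \<comment> \<open>In the second component the left side of \<open>invariant_constant_part\<close>
    is 0 and \<open>L\<close> is the identity, so the constant term of \<open>\<eta>\<close>
    vanishes there; by \<open>b\<close> it is also \<open>\<xi>\<^sup>0\<^sub>t / 2\<close>.\<close>
  have tau: "dt (xi0 X) p = 0" if p: "p \<in> D" for p
  proof -
    have "dx (dx (eta X)) p $ 2 = dx (\<lambda>p. dx (eta X) p $ 2) p"
      by (rule dird_vec_nth[OF smooth_coeffs1(3) p, symmetric])
    also have "\<dots> = 0" by (rule dird_zero_on[OF open_D p eta2]) simp_all
    finally have "lv_linear \<beta>1 \<beta>3 (eta X p + dt (xi0 X) p *\<^sub>R snd (snd p)) $ 2 = 0"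
      using arg_cong[OF invariant_constant_part[of "fst p" "fst (snd p)" "snd (snd p)"],
          where f = "\<lambda>v. v $ 2"] eta2[OF p] p by simp
    then have "(eta X p + dt (xi0 X) p *\<^sub>R snd (snd p)) $ 2 = 0"
      unfolding lv_linear_def vector_3 .
    then show ?thesis using b(1)[OF p] by simp
  qed
  have grad: "dird k f p = 0" if "smooth_on D f" "p \<in> D" "dt f p = 0" "dx f p = 0" "\<And>Y. dU Y f p = 0"
    for f :: "base \<Rightarrow> real" and p k
  proof -
    obtain r s Y where k: "k = (r, s, Y)" by (cases k)
    have "k = r *\<^sub>R (1, 0, 0) + s *\<^sub>R (0, 1, 0) + (0, 0, Y)" by (simp add: k)
    then have "dird k f p = r *\<^sub>R dt f p + s *\<^sub>R dx f p + dU Y f p"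
      by (simp only: linear_add[OF smooth_on_linear_dird[OF that(1,2)]]
          linear_scale[OF smooth_on_linear_dird[OF that(1,2)]])
    then show ?thesis using that by simp
  qed
  \<comment> \<open>All partial derivatives vanish, \<open>\<xi>\<^sup>1\<^sub>x\<close> being half
    of \<open>\<xi>\<^sup>0\<^sub>t\<close>, and \<open>D\<close> is connected.\<close>
  have "xi0 X p = xi0 X q" "xi1 X p = xi1 X q" if "p \<in> D" "q \<in> D" for p q
    by (rule gradient_zero_constant[OF assms(13,14) _ grad that];
        simp add: smooth_coeffs tau xi0_x xi0_U xi1_t xi1_U; use xi0_t tau in simp)+
  then obtain a b where "\<forall>p\<in>D. xi0 X p = a \<and> xi1 X p = b" by metis
  moreover have "eta X p = 0" if "p \<in> D" for p
    using b(2)[OF that] tau[OF that] by simp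
  ultimately show "\<exists>a b. \<forall>p\<in>D. X p = a *\<^sub>R P_t p + b *\<^sub>R P_x p"
    by (intro exI[of _ a] exI[of _ b])
       (auto simp: P_t_def P_x_def prod_eq_iff xi0_def xi1_def eta_def)
qed

end
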